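(* Let $I=[-1,1]$, $\alpha>1$, $c>0$, and let $M_n=\exp(cn^\alpha)$ for $n\ge0$. If $\psi\in\mathcal C_M(I)$ is real-valued, then $m_\psi(\lambda)=O\bigl((\log\lambda)^{1-\frac1\alpha}\bigr)$ as $\lambda\to\infty$. This bound is sharp: there exist a real-valued $\psi\in\mathcal C_M(I)$ and a sequence $\lambda_n\to\infty$ such that $$|m_\psi(\lambda_n)|\approx(\log\lambda_n)^{1-\frac1\alpha}$$ for all sufficiently large $n$.
   Context: For a real-valued $\psi\in C^1(I)$, $I=[-1,1]$, and $\lambda>0$, $m_\psi(\lambda):=\mathrm{p.v.}\int_{-1}^{1}e^{i\lambda\psi(t)}\frac{dt}{t}=\lim_{\varepsilon\to0^+}\int_{\varepsilon\le|t|\le1}e^{i\lambda\psi(t)}\frac{dt}{t}$. A function $\psi\in C^\infty(I)$ belongs to $\mathcal C_M(I)$ if there is a constant $K>0$ such that $\sup_{t\in I}|\psi^{(n)}(t)|\le K^{n+1}M_n=K^{n+1}\exp(cn^\alpha)$ for all $n\ge0$. Implicit constants may depend on $\psi,\alpha,c$ but not on $\lambda$. $X\approx Y$ means $c'Y\le X\le C'Y$ for some constants $c',C'>0$ independent of $n$ (and of $\lambda_n$). *)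

theory Defs
  imports "HOL-Analysis.Analysis" "HOL-Library.Landau_Symbols"
begin

text \<open>
  Iterated derivatives relative to a set \<open>S\<close>. On a nondegenerate closed interval these are the
  usual derivatives, one-sided at the endpoints, and depend only on the values of \<open>f\<close> on \<open>S\<close>.
\<close>
primrec deriv_within :: "real set \<Rightarrow> nat \<Rightarrow> (real \<Rightarrow> real) \<Rightarrow> real \<Rightarrow> real" where
  "deriv_within S 0 f = f"
| "deriv_within S (Suc n) f = (\<lambda>t. vector_derivative (deriv_within S n f) (at t within S))"

definition smooth_on :: "real set \<Rightarrow> (real \<Rightarrow> real) \<Rightarrow> bool" where
  "smooth_on S f \<longleftrightarrow> (\<forall>n. deriv_within S n f differentiable_on S)"

text \<open>
  The Denjoy--Carleman class of real-valued functions with weight sequence \<open>M\<close> on \<open>S\<close>, used for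
  nonempty compact \<open>S\<close>, where smoothness guarantees that the suprema are over bounded sets.
\<close>
definition carleman_class :: "(nat \<Rightarrow> real) \<Rightarrow> real set \<Rightarrow> (real \<Rightarrow> real) set" where
  "carleman_class M S = {f. smooth_on S f \<and>
     (\<exists>K>0. \<forall>n. (SUP t\<in>S. \<bar>deriv_within S n f t\<bar>) \<le> K ^ (n + 1) * M n)}"

text \<open>
  The principal value integral; the limit exists whenever \<open>\<psi>\<close> is continuously differentiable
  on \<open>{-1..1}\<close>.
\<close>
definition pv_osc :: "(real \<Rightarrow> real) \<Rightarrow> real \<Rightarrow> complex" where
  "pv_osc \<psi> l = Lim (at_right 0) (\<lambda>\<epsilon>.
     integral {t. \<epsilon> \<le> \<bar>t\<bar> \<and> \<bar>t\<bar> \<le> 1} (\<lambda>t. exp (\<i> * of_real (l * \<psi> t)) / of_real t))"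

end

theory Submission
  imports Defs "HOL-Real_Asymp.Real_Asymp"
begin

text \<open>
  After reflection of the negative half-line, the principal value is the integral over \<open>{0..1}\<close> of
  \<open>(exp (\<i> l \<psi>(t)) - exp (\<i> l \<psi>(-t))) / t\<close>, and the question is below which \<open>\<delta>\<close> the two
  sides cancel. Above \<open>\<delta>\<close> the absolute value of the integral is trivially at most \<open>2 ln (1 / \<delta>)\<close>.

  Upper bound. If some derivative of positive order of \<open>\<psi>\<close> does not vanish at 0, then \<open>\<psi> - \<psi>(0)\<close>
  behaves like a monomial of some degree \<open>k\<close>; cancellation below \<open>l powr (- 1 / k)\<close> and integration by
  parts above it show that the integral is bounded (\<open>pv_osc_bounded_finite_order\<close>). If \<open>\<psi>\<close> is flat
  at 0, then \<open>\<bar>\<psi>(t) - \<psi>(-t)\<bar>\<close> is at most \<open>2 K ^ (n + 1) exp (c n powr \<alpha>) t ^ n\<close> for all \<open>n\<close>. Taking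
  \<open>n\<close> of order \<open>(ln l) powr (1 / \<alpha>)\<close> shows that the two sides cancel below a \<open>\<delta>\<close>
  with \<open>ln (1 / \<delta>)\<close> of order \<open>(ln l) powr (1 - 1 / \<alpha>)\<close>, and the trivial bound above \<open>\<delta>\<close> gives the claim
  (\<open>norm_pv_osc_le_of_flat\<close>).

  Sharpness. Let \<open>\<psi>\<close> vanish for \<open>t \<le> 0\<close> and be convex. Then the left side contributes
  \<open>- ln (1 / \<delta>)\<close>, while the right side oscillates and contributes a bounded amount as soon as
  \<open>l \<delta> \<psi>'(\<delta>)\<close> is bounded below (\<open>norm_pv_osc_ge\<close>). So \<open>\<psi>\<close> has to be flat at 0 and
  otherwise as large as possible for \<open>t > 0\<close>; the largest order that the class permits is
  \<open>exp (- A (ln (1 / t)) powr (\<alpha> / (\<alpha> - 1)))\<close>. A function of this kind is the sum over \<open>k\<close> of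
  \<open>exp (- A k powr (\<alpha> / (\<alpha> - 1))) E(2 ^ k t)\<close> with \<open>E(x) = x exp (- 1 / x)\<close> for \<open>x > 0\<close>, extended
  by 0. Its derivatives are bounded term by term, and it lies in the class when \<open>A\<close> is large
  (\<open>ramp_series_in_carleman_class\<close>). Along \<open>l = exp (A k powr (\<alpha> / (\<alpha> - 1)))\<close> and
  \<open>\<delta> = 2 powr (- k)\<close> both \<open>ln (1 / \<delta>)\<close> and \<open>(ln l) powr (1 - 1 / \<alpha>)\<close> are proportional to \<open>k\<close>.
\<close>

section \<open>Sequences of successive derivatives\<close>

text \<open>
  Working with a whole sequence \<open>f 0, f 1, \<dots>\<close> of successive derivatives, instead of
  iterating a derivative operator, lets the derivatives be given by formulas and lets reflection,
  restriction and differences be formed termwise.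
\<close>
definition derivative_chain :: "real set \<Rightarrow> (nat \<Rightarrow> real \<Rightarrow> real) \<Rightarrow> bool" where
  "derivative_chain S f \<longleftrightarrow>
     (\<forall>n. \<forall>t\<in>S. (f n has_real_derivative f (Suc n) t) (at t within S))"

lemma derivative_chainD:
  "derivative_chain S f \<Longrightarrow> t \<in> S \<Longrightarrow> (f n has_real_derivative f (Suc n) t) (at t within S)"
  by (simp add: derivative_chain_def)

lemma derivative_chain_subset:
  "derivative_chain T f \<Longrightarrow> S \<subseteq> T \<Longrightarrow> derivative_chain S f"
  unfolding derivative_chain_def by (meson DERIV_subset subsetD)

lemma derivative_chain_continuous_on:
  "derivative_chain S f \<Longrightarrow> continuous_on S (f n)"
  by (rule DERIV_continuous_on) (rule derivative_chainD)

lemma derivative_chain_reflect: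
  assumes "derivative_chain {-1..1} f"
  shows "derivative_chain {-1..1} (\<lambda>n t. (-1) ^ n * f n (- t))"
  unfolding derivative_chain_def
proof (intro allI ballI)
  fix n and t :: real assume t: "t \<in> {-1..1}"
  have 1: "(f n has_real_derivative f (Suc n) (- t)) (at (- t) within uminus ` {-1..1})"
    using derivative_chainD[OF assms, of "- t" n] t by simp
  have "(f n \<circ> uminus has_real_derivative f (Suc n) (- t) * (- 1)) (at t within {-1..1})"
    by (rule DERIV_image_chain[OF 1]) (auto intro!: derivative_eq_intros)
  from DERIV_cmult[OF this, of "(-1) ^ n"]
  show "((\<lambda>t. (-1) ^ n * f n (- t)) has_real_derivative (-1) ^ Suc n * f (Suc n) (- t))
          (at t within {-1..1})"
    by (simp add: o_def)
qed

lemma deriv_within_derivative_chain: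
  assumes f: "derivative_chain {a..b} f" and ab: "a < b" and t: "t \<in> {a..b}"
  shows "deriv_within {a..b} n (f 0) t = f n t"
  using t
proof (induction n arbitrary: t)
  case (Suc n)
  have "(f n has_vector_derivative f (Suc n) t) (at t within {a..b})"
    using derivative_chainD[OF f Suc.prems] by (simp add: has_real_derivative_iff_has_vector_derivative)
  then have "(deriv_within {a..b} n (f 0) has_vector_derivative f (Suc n) t) (at t within {a..b})"
    by (rule has_vector_derivative_transform[OF Suc.prems Suc.IH, rotated])
  from vector_derivative_within_closed_interval[OF ab Suc.prems this]
  show ?case by simp
qed simp

lemma derivative_chain_in_carleman_class:
  assumes f: "derivative_chain {-1..1} f" and K: "K > 0"
    and bound: "\<And>n t. t \<in> {-1..1} \<Longrightarrow> \<bar>f n t\<bar> \<le> K ^ (n + 1) * M n"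
  shows "f 0 \<in> carleman_class M {-1..1}"
proof -
  have eq: "deriv_within {-1..1} n (f 0) t = f n t" if "t \<in> {-1..1}" for n t
    using deriv_within_derivative_chain[OF f _ that] by simp
  have "smooth_on {-1..1} (f 0)"
    unfolding smooth_on_def differentiable_on_def
  proof (intro allI ballI)
    fix n and t :: real assume t: "t \<in> {-1..1}"
    have "f n differentiable (at t within {-1..1})"
      using derivative_chainD[OF f t] has_field_derivative_imp_has_derivative differentiable_def
      by blast
    then show "deriv_within {-1..1} n (f 0) differentiable (at t within {-1..1})"
      by (rule differentiable_transform_within[OF _ zero_less_one t]) (simp add: eq)
  qed
  moreover have "(SUP t\<in>{-1..1}. \<bar>deriv_within {-1..1} n (f 0) t\<bar>) \<le> K ^ (n + 1) * M n" for n
    using bound by (intro cSUP_least) (auto simp: eq)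
  ultimately show ?thesis using K by (auto simp: carleman_class_def)
qed

text \<open>
  The supremum in the definition of the class controls pointwise values because each derivative is
  continuous on a compact interval, so that the supremum is taken over a bounded set. Enlarging the
  constant to be at least 1 makes its powers monotone.
\<close>
lemma carleman_class_derivative_chain:
  assumes "\<psi> \<in> carleman_class M {-1..1}" and M: "\<And>n. M n \<ge> 0"
  obtains f K where "f 0 = \<psi>" "derivative_chain {-1..1} f" "K \<ge> 1"
    "\<And>n t. t \<in> {-1..1} \<Longrightarrow> \<bar>f n t\<bar> \<le> K ^ (n + 1) * M n"
proof -
  define f where "f = (\<lambda>n. deriv_within {-1..1} n \<psi>)"
  from assms obtain K where sm: "smooth_on {-1..1} \<psi>" and K: "K > 0"
    "\<And>n. (SUP t\<in>{-1..1}. \<bar>f n t\<bar>) \<le> K ^ (n + 1) * M n"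
    by (auto simp: carleman_class_def f_def)
  have chain: "derivative_chain {-1..1} f"
    unfolding derivative_chain_def
  proof (intro allI ballI)
    fix n and t :: real assume t: "t \<in> {-1..1}"
    have "f n differentiable (at t within {-1..1})"
      using sm t by (auto simp: smooth_on_def differentiable_on_def f_def)
    then show "(f n has_real_derivative f (Suc n) t) (at t within {-1..1})"
      by (simp add: vector_derivative_works has_real_derivative_iff_has_vector_derivative f_def)
  qed
  have "\<bar>f n t\<bar> \<le> max 1 K ^ (n + 1) * M n" if t: "t \<in> {-1..1}" for n t
  proof -
    have "compact ((\<lambda>t. \<bar>f n t\<bar>) ` {-1..1})"
      by (intro compact_continuous_image continuous_intros derivative_chain_continuous_on chain)
         simp
    then have "\<bar>f n t\<bar> \<le> (SUP t\<in>{-1..1}. \<bar>f n t\<bar>)"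
      using t by (intro cSUP_upper bounded_imp_bdd_above compact_imp_bounded)
    also have "\<dots> \<le> K ^ (n + 1) * M n" by (rule K)
    also have "\<dots> \<le> max 1 K ^ (n + 1) * M n"
      using K(1) M by (intro mult_right_mono power_mono) auto
    finally show ?thesis .
  qed
  then show ?thesis using chain by (intro that[of f "max 1 K"]) (auto simp: f_def)
qed

section \<open>Functions with vanishing derivatives at the origin\<close>

text \<open>
  Taylor's bound without the factorial: since the derivatives of orders \<open>n\<close> to \<open>m - 1\<close> vanish at
  0, the bound on the derivative of order \<open>m\<close> passes to lower orders by the mean value inequality,
  each step contributing one factor \<open>t\<close>. The lower end \<open>n\<close> is a parameter because the function
  itself usually does not vanish at 0 while its derivatives do.
\<close>
lemma vanishing_derivatives_upper:
  fixes f :: "nat \<Rightarrow> real \<Rightarrow> real"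
  assumes f: "derivative_chain {0..1} f"
    and B: "\<And>t. t \<in> {0..1} \<Longrightarrow> \<bar>f m t\<bar> \<le> B"
    and van: "\<And>j. n \<le> j \<Longrightarrow> j < m \<Longrightarrow> f j 0 = 0"
    and nj: "n \<le> j" "j \<le> m" and t: "t \<in> {0..1}"
  shows "\<bar>f j t\<bar> \<le> B * t ^ (m - j)"
  using nj(2,1) t
proof (induction j arbitrary: t rule: inc_induct)
  case base
  then show ?case using B by simp
next
  case (step j)
  have B0: "0 \<le> B" using B[of 0] by auto
  have "norm (f j t - f j 0) \<le> (B * t ^ (m - Suc j)) * norm (t - 0)"
  proof (rule field_differentiable_bound)
    show "(f j has_field_derivative f (Suc j) x) (at x within {0..t})" if "x \<in> {0..t}" for x
      using derivative_chainD[OF derivative_chain_subset[OF f]] that step.prems by auto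
    show "norm (f (Suc j) x) \<le> B * t ^ (m - Suc j)" if "x \<in> {0..t}" for x
    proof -
      have "\<bar>f (Suc j) x\<bar> \<le> B * x ^ (m - Suc j)" using step that by auto
      also have "\<dots> \<le> B * t ^ (m - Suc j)"
        using that B0 by (intro mult_left_mono power_mono) auto
      finally show ?thesis by simp
    qed
  qed (use step.prems in auto)
  moreover have "t ^ (m - j) = t ^ (m - Suc j) * t"
    using step.hyps by (metis Suc_diff_Suc power_Suc2)
  ultimately show ?case using van[of j] step by (simp add: mult.assoc)
qed

text \<open>
  The matching lower bound on one side of 0; \<open>\<sigma>\<close> is the sign of the first derivative that does
  not vanish at 0.
\<close>
lemma vanishing_derivatives_lower:
  fixes f :: "nat \<Rightarrow> real \<Rightarrow> real"
  assumes f: "derivative_chain {0..1} f" and r: "r \<le> 1"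
    and b: "\<And>t. t \<in> {0..r} \<Longrightarrow> b \<le> \<sigma> * f m t"
    and van: "\<And>j. n \<le> j \<Longrightarrow> j < m \<Longrightarrow> f j 0 = 0"
    and nj: "n \<le> j" "j \<le> m" and t: "t \<in> {0..r}"
  shows "b * t ^ (m - j) / fact (m - j) \<le> \<sigma> * f j t"
  using nj(2,1) t
proof (induction j arbitrary: t rule: inc_induct)
  case base
  then show ?case using b by simp
next
  case (step j)
  define i where "i = m - Suc j"
  have mj: "m - j = Suc i" using step.hyps by (simp add: i_def)
  define h where "h = (\<lambda>x. \<sigma> * f j x - b * x ^ Suc i / fact (Suc i))"
  have der: "(h has_real_derivative \<sigma> * f (Suc j) x - b * x ^ i / fact i) (at x within {0..t})"
    if "x \<in> {0..t}" for x
  proof -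
    have "(f j has_real_derivative f (Suc j) x) (at x within {0..t})"
      using derivative_chainD[OF derivative_chain_subset[OF f]] that step.prems r by auto
    moreover have "b * (real (Suc i) * x ^ i) / fact (Suc i) = b * x ^ i / fact i"
      by (simp only: fact_Suc) (simp add: field_simps del: of_nat_Suc)
    ultimately show ?thesis unfolding h_def
      by (auto intro!: derivative_eq_intros simp: mult_ac simp del: power_Suc of_nat_Suc fact_Suc)
  qed
  have "h 0 \<le> h t"
  proof (rule DERIV_nonneg_imp_increasing_open[where f = h])
    show "0 \<le> t" using step.prems by simp
    show "continuous_on {0..t} h" by (rule DERIV_continuous_on) (rule der)
    show "\<exists>y. (h has_real_derivative y) (at x) \<and> 0 \<le> y" if "0 < x" "x < t" for x
      using der[of x] step.IH[of x] that step.prems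
      by (auto simp: at_within_Icc_at i_def intro!: exI[of _ "\<sigma> * f (Suc j) x - b * x ^ i / fact i"])
  qed
  then show ?case using van[of j] step by (simp add: h_def mj)
qed

section \<open>Oscillatory integrals with a logarithmic singularity\<close>

definition osc_kernel :: "(real \<Rightarrow> real) \<Rightarrow> real \<Rightarrow> real \<Rightarrow> complex" where
  "osc_kernel \<psi> l t = exp (\<i> * of_real (l * \<psi> t)) / of_real t"

lemma norm_exp_i_diff_le: "norm (exp (\<i> * of_real x) - exp (\<i> * of_real y)) \<le> \<bar>x - y\<bar>"
proof -
  have "exp (\<i> * of_real x) - exp (\<i> * of_real y)
      = exp (\<i> * of_real y) * (exp (\<i> * of_real (x - y)) - 1)"
    by (simp add: algebra_simps flip: exp_add)
  then have "norm (exp (\<i> * of_real x) - exp (\<i> * of_real y)) = 2 * \<bar>sin ((x - y) / 2)\<bar>"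
    by (simp only: norm_mult norm_exp_i_times dist_exp_i_1)
  also have "\<dots> \<le> \<bar>x - y\<bar>" using abs_sin_x_le_abs_x[of "(x - y) / 2"] by simp
  finally show ?thesis .
qed

lemma osc_kernel_integrable:
  assumes "0 < a" "continuous_on {a..b} \<psi>"
  shows "osc_kernel \<psi> l integrable_on {a..b}"
  unfolding osc_kernel_def using assms
  by (intro integrable_continuous_real continuous_intros) auto

lemma norm_integral_osc_kernel_le_ln:
  assumes "0 < a" "a \<le> b" "continuous_on {a..b} \<psi>"
  shows "norm (integral {a..b} (osc_kernel \<psi> l)) \<le> ln b - ln a"
proof -
  have *: "((\<lambda>t. 1 / t) has_integral ln b - ln a) {a..b}"
    using assms
    by (intro fundamental_theorem_of_calculus)
       (auto simp: has_real_derivative_iff_has_vector_derivative[symmetric]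
             intro!: derivative_eq_intros)
  have "norm (integral {a..b} (osc_kernel \<psi> l)) \<le> integral {a..b} (\<lambda>t. 1 / t)"
    using assms *
    by (intro integral_norm_bound_integral osc_kernel_integrable)
       (auto simp: osc_kernel_def norm_divide simp del: of_real_mult)
  then show ?thesis using * by (simp add: integral_unique)
qed

text \<open>
  Near the singularity the integrals over \<open>t > 0\<close> and \<open>t < 0\<close> cancel: two phases that agree to order
  \<open>n\<close> at 0 differ by a kernel of size \<open>l C t ^ (n - 1)\<close>, which is integrable at 0.
\<close>
lemma norm_integral_osc_kernel_diff_le:
  assumes "0 < a" "a \<le> b" "l \<ge> 0" "C \<ge> 0" "n \<ge> 1"
    and "continuous_on {a..b} \<psi>" "continuous_on {a..b} \<phi>"
    and diff: "\<And>t. t \<in> {a..b} \<Longrightarrow> \<bar>\<psi> t - \<phi> t\<bar> \<le> C * t ^ n"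
  shows "norm (integral {a..b} (\<lambda>t. osc_kernel \<psi> l t - osc_kernel \<phi> l t)) \<le> l * C * b ^ n"
proof -
  have "norm (osc_kernel \<psi> l t - osc_kernel \<phi> l t) \<le> l * C * b ^ (n - 1)" if t: "t \<in> {a..b}" for t
  proof -
    have t0: "t > 0" using t assms by simp
    have "norm (osc_kernel \<psi> l t - osc_kernel \<phi> l t)
        = norm (exp (\<i> * of_real (l * \<psi> t)) - exp (\<i> * of_real (l * \<phi> t))) / t"
      using t0 by (simp add: osc_kernel_def norm_divide flip: diff_divide_distrib)
    also have "\<dots> \<le> \<bar>l * \<psi> t - l * \<phi> t\<bar> / t"
      using t0 by (intro divide_right_mono norm_exp_i_diff_le) auto
    also have "\<dots> = l * \<bar>\<psi> t - \<phi> t\<bar> / t"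
      using \<open>l \<ge> 0\<close> by (simp add: abs_mult flip: right_diff_distrib)
    also have "\<dots> \<le> l * (C * t ^ n) / t"
      using t0 \<open>l \<ge> 0\<close> diff[OF t] by (intro divide_right_mono mult_left_mono) auto
    also have "\<dots> = l * C * t ^ (n - 1)"
      using t0 \<open>n \<ge> 1\<close> by (cases n) auto
    also have "\<dots> \<le> l * C * b ^ (n - 1)"
      using t assms by (intro mult_left_mono power_mono) auto
    finally show ?thesis .
  qed
  then have "norm (integral {a..b} (\<lambda>t. osc_kernel \<psi> l t - osc_kernel \<phi> l t))
      \<le> integral {a..b} (\<lambda>t. l * C * b ^ (n - 1))"
    using assms
    by (intro integral_norm_bound_integral integrable_diff osc_kernel_integrable) auto
  also have "\<dots> = (b - a) * (l * C * b ^ (n - 1))" using assms by simp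
  also have "\<dots> \<le> b * (l * C * b ^ (n - 1))"
    using assms by (intro mult_right_mono) auto
  also have "\<dots> = l * C * b ^ n"
    using \<open>n \<ge> 1\<close> by (cases n) auto
  finally show ?thesis .
qed

text \<open>
  A van der Corput estimate. With \<open>g = 1 / (t \<psi>')\<close>, the function
  \<open>exp (\<i> l \<psi>) g / (\<i> l)\<close> is an antiderivative of the kernel up to the error
  \<open>exp (\<i> l \<psi>) g' / (\<i> l)\<close>. The variation of \<open>g\<close> is measured by a decreasing majorant
  \<open>G\<close>: for a phase that behaves like a monomial this is a multiple of a negative power of \<open>t\<close>, and
  for a decreasing \<open>g\<close> it is \<open>g\<close> itself.
\<close>
lemma norm_integral_osc_kernel_by_parts:
  fixes \<psi> \<psi>' g g' G G' :: "real \<Rightarrow> real"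
  assumes ab: "0 < a" "a \<le> b" and l: "l > 0"
    and \<psi>: "\<And>t. t \<in> {a..b} \<Longrightarrow> (\<psi> has_real_derivative \<psi>' t) (at t within {a..b})"
    and g: "\<And>t. t \<in> {a..b} \<Longrightarrow> (g has_real_derivative g' t) (at t within {a..b})"
    and G: "\<And>t. t \<in> {a..b} \<Longrightarrow> (G has_real_derivative G' t) (at t within {a..b})"
    and inv: "\<And>t. t \<in> {a..b} \<Longrightarrow> g t * (t * \<psi>' t) = 1"
    and dom: "\<And>t. t \<in> {a..b} \<Longrightarrow> \<bar>g' t\<bar> \<le> - G' t"
  shows "norm (integral {a..b} (osc_kernel \<psi> l)) \<le> (\<bar>g a\<bar> + \<bar>g b\<bar> + (G a - G b)) / l"
proof -
  define e where "e t = exp (\<i> * of_real (l * \<psi> t))" for t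
  define F where "F t = e t * of_real (g t) / (\<i> * of_real l)" for t
  define R where "R t = e t * of_real (g' t) / (\<i> * of_real l)" for t
  have ne: "norm (e t) = 1" for t by (simp add: e_def del: of_real_mult)
  have F': "(F has_vector_derivative osc_kernel \<psi> l t + R t) (at t within {a..b})"
    if t: "t \<in> {a..b}" for t
  proof -
    have "((\<lambda>t. \<i> * of_real (l * \<psi> t)) has_vector_derivative \<i> * of_real (l * \<psi>' t))
            (at t within {a..b})"
      using DERIV_cmult[OF \<psi>[OF t], of l]
      by (intro has_vector_derivative_mult_right has_vector_derivative_of_real)
    from field_vector_diff_chain_within[OF this, of exp]
    have e': "(e has_vector_derivative \<i> * of_real (l * \<psi>' t) * e t) (at t within {a..b})"
      by (simp add: o_def e_def[abs_def] DERIV_exp has_field_derivative_at_within)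
    have "((\<lambda>t. complex_of_real (g t)) has_vector_derivative of_real (g' t)) (at t within {a..b})"
      by (rule has_vector_derivative_of_real) (rule g[OF t])
    from has_vector_derivative_divide[OF has_vector_derivative_mult[OF e' this], of "\<i> * of_real l"]
    have "(F has_vector_derivative
        (e t * of_real (g' t) + \<i> * of_real (l * \<psi>' t) * e t * of_real (g t)) / (\<i> * of_real l))
        (at t within {a..b})"
      by (simp add: F_def[abs_def])
    moreover have "\<i> * of_real (l * \<psi>' t) * e t * of_real (g t) / (\<i> * of_real l) = osc_kernel \<psi> l t"
    proof -
      have t0: "t > 0" using t ab by simp
      then have "\<psi>' t * g t = 1 / t" using inv[OF t] by (simp add: field_simps)
      then have "complex_of_real (\<psi>' t) * of_real (g t) = 1 / of_real t"
        by (metis of_real_1 of_real_divide of_real_mult)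
      moreover have "\<i> * of_real (l * \<psi>' t) * e t * of_real (g t) / (\<i> * of_real l)
          = e t * (of_real (\<psi>' t) * of_real (g t))"
        using l by (simp add: field_simps)
      ultimately show ?thesis by (simp add: osc_kernel_def e_def)
    qed
    ultimately show ?thesis by (simp add: add_divide_distrib R_def add.commute)
  qed
  have cont: "continuous_on {a..b} \<psi>" by (rule DERIV_continuous_on) (rule \<psi>)
  have iF: "((\<lambda>t. osc_kernel \<psi> l t + R t) has_integral F b - F a) {a..b}"
    by (intro fundamental_theorem_of_calculus ab F')
  have iK: "(osc_kernel \<psi> l has_integral integral {a..b} (osc_kernel \<psi> l)) {a..b}"
    by (intro integrable_integral osc_kernel_integrable ab cont)
  have iR: "(R has_integral F b - F a - integral {a..b} (osc_kernel \<psi> l)) {a..b}"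
    using has_integral_diff[OF iF iK] by simp
  have "((\<lambda>t. - G' t / l) has_integral - G b / l - - G a / l) {a..b}"
    by (intro fundamental_theorem_of_calculus ab)
       (use l in \<open>auto simp: has_real_derivative_iff_has_vector_derivative[symmetric]
          intro!: derivative_eq_intros G\<close>)
  then have iG: "((\<lambda>t. - G' t / l) has_integral (G a - G b) / l) {a..b}"
    by (simp add: diff_divide_distrib)
  have "norm (integral {a..b} R) \<le> integral {a..b} (\<lambda>t. - G' t / l)"
  proof (rule integral_norm_bound_integral)
    show "norm (R t) \<le> - G' t / l" if "t \<in> {a..b}" for t
      using divide_right_mono[OF dom[OF that], of l] l by (simp add: R_def norm_mult norm_divide ne)
  qed (use iR iG in auto)
  then have R: "norm (F b - F a - integral {a..b} (osc_kernel \<psi> l)) \<le> (G a - G b) / l"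
    by (simp only: integral_unique[OF iR] integral_unique[OF iG])
  have nF: "norm (F t) = \<bar>g t\<bar> / l" for t
    using l by (simp add: F_def norm_mult norm_divide ne)
  have "norm (integral {a..b} (osc_kernel \<psi> l))
      = norm (F b - F a - (F b - F a - integral {a..b} (osc_kernel \<psi> l)))" by simp
  also have "\<dots> \<le> norm (F b) + norm (F a) + (G a - G b) / l"
    using R norm_triangle_ineq4[of "F b" "F a"]
      norm_triangle_ineq4[of "F b - F a" "F b - F a - integral {a..b} (osc_kernel \<psi> l)"]
    by linarith
  finally show ?thesis using l by (simp add: nF add_divide_distrib add.commute)
qed

text \<open>
  Reflecting the negative half-line turns the truncated integral into an integral over
  \<open>{\<epsilon>..1}\<close> of a difference of two kernels, in which the singularity at 0 cancels.
\<close>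
lemma pv_osc_truncation:
  assumes "0 < \<epsilon>" "\<epsilon> \<le> 1" and \<psi>: "continuous_on {-1..1} \<psi>"
  shows "integral {t. \<epsilon> \<le> \<bar>t\<bar> \<and> \<bar>t\<bar> \<le> 1} (\<lambda>t. exp (\<i> * of_real (l * \<psi> t)) / of_real t)
       = integral {\<epsilon>..1} (\<lambda>t. osc_kernel \<psi> l t - osc_kernel (\<lambda>t. \<psi> (- t)) l t)"
proof -
  let ?\<phi> = "\<lambda>t. \<psi> (- t)"
  have c: "continuous_on {\<epsilon>..1} \<psi>" "continuous_on {\<epsilon>..1} ?\<phi>"
    using assms by (auto intro!: continuous_on_subset[OF \<psi>] continuous_on_compose2[OF \<psi>] continuous_intros)
  have 1: "(osc_kernel \<psi> l has_integral integral {\<epsilon>..1} (osc_kernel \<psi> l)) {\<epsilon>..1}"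
    and 2: "(osc_kernel ?\<phi> l has_integral integral {\<epsilon>..1} (osc_kernel ?\<phi> l)) {\<epsilon>..1}"
    using assms c by (auto intro!: integrable_integral osc_kernel_integrable)
  have "((\<lambda>t. osc_kernel ?\<phi> l (- t)) has_integral integral {\<epsilon>..1} (osc_kernel ?\<phi> l)) {- 1..- \<epsilon>}"
    using 2 by simp
  from has_integral_neg[OF this]
  have 3: "(osc_kernel \<psi> l has_integral - integral {\<epsilon>..1} (osc_kernel ?\<phi> l)) {- 1..- \<epsilon>}"
    by (simp add: osc_kernel_def[abs_def])
  have "{t. \<epsilon> \<le> \<bar>t\<bar> \<and> \<bar>t\<bar> \<le> 1} = {\<epsilon>..1} \<union> {- 1..- \<epsilon>}" using assms by auto
  moreover have "{\<epsilon>..1} \<inter> {- 1..- \<epsilon>} = {}" using assms by auto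
  ultimately have "(osc_kernel \<psi> l has_integral
      integral {\<epsilon>..1} (osc_kernel \<psi> l) + - integral {\<epsilon>..1} (osc_kernel ?\<phi> l))
      {t. \<epsilon> \<le> \<bar>t\<bar> \<and> \<bar>t\<bar> \<le> 1}"
    using has_integral_Un[OF 1 3] by simp
  moreover have "integral {\<epsilon>..1} (\<lambda>t. osc_kernel \<psi> l t - osc_kernel ?\<phi> l t)
      = integral {\<epsilon>..1} (osc_kernel \<psi> l) - integral {\<epsilon>..1} (osc_kernel ?\<phi> l)"
    using 1 2 by (intro integral_diff) auto
  ultimately show ?thesis
    by (simp add: integral_unique osc_kernel_def[abs_def])
qed

text \<open>
  The difference of the two kernels is the difference quotient at 0 of a function that is
  differentiable there, so it extends continuously to \<open>{0..1}\<close>. Hence the principal value exists,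
  and all estimates of it reduce to estimates of the truncated integrals.
\<close>
lemma tendsto_pv_osc:
  assumes \<psi>: "\<And>t. t \<in> {-1..1} \<Longrightarrow> (\<psi> has_real_derivative \<psi>' t) (at t within {-1..1})"
  shows "((\<lambda>\<epsilon>. integral {\<epsilon>..1} (\<lambda>t. osc_kernel \<psi> l t - osc_kernel (\<lambda>t. \<psi> (- t)) l t))
           \<longlongrightarrow> pv_osc \<psi> l) (at_right 0)"
proof -
  let ?\<phi> = "\<lambda>t. \<psi> (- t)"
  define u where "u t = exp (\<i> * of_real (l * \<psi> t)) - exp (\<i> * of_real (l * \<psi> (- t)))" for t
  define h where "h = (\<lambda>t. osc_kernel \<psi> l t - osc_kernel ?\<phi> l t)"
  have h_u: "h t = u t / of_real t" for t by (simp add: h_def u_def osc_kernel_def diff_divide_distrib)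
  have cont: "continuous_on {-1..1} \<psi>" by (rule DERIV_continuous_on) (rule \<psi>)
  have d0: "(\<psi> has_real_derivative \<psi>' 0) (at 0)"
    using \<psi>[of 0] by (simp add: at_within_Icc_at)
  have "(\<psi> \<circ> uminus has_real_derivative \<psi>' 0 * (- 1)) (at 0)"
    by (rule DERIV_chain) (use d0 in \<open>auto intro!: derivative_eq_intros\<close>)
  then have d1: "(?\<phi> has_real_derivative - \<psi>' 0) (at 0)" by (simp add: o_def)
  have e': "((\<lambda>t. exp (\<i> * of_real (l * p t))) has_vector_derivative
      (\<i> * of_real (l * p')) * exp (\<i> * of_real (l * p 0))) (at 0)"
    if "(p has_real_derivative p') (at 0)" for p p'
  proof -
    have "((\<lambda>t. \<i> * of_real (l * p t)) has_vector_derivative \<i> * of_real (l * p')) (at 0)"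
      using DERIV_cmult[OF that, of l]
      by (intro has_vector_derivative_mult_right has_vector_derivative_of_real)
    from field_vector_diff_chain_at[OF this, of exp]
    show ?thesis by (simp add: o_def DERIV_exp)
  qed
  obtain D where "(u has_vector_derivative D) (at 0)"
    using has_vector_derivative_diff[OF e'[OF d0] e'[OF d1]] by (auto simp: u_def[abs_def])
  then have "((\<lambda>t. norm (u t - t *\<^sub>R D) / norm t) \<longlongrightarrow> 0) (at 0)"
    by (simp add: has_vector_derivative_def has_derivative_at u_def)
  then have "((\<lambda>t. norm (h t - D)) \<longlongrightarrow> 0) (at 0)"
  proof (rule Lim_transform_eventually)
    have "norm (u t - t *\<^sub>R D) / norm t = norm (h t - D)" if "t \<noteq> 0" for t
    proof -
      have "h t - D = (u t - t *\<^sub>R D) / of_real t"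
        using that by (simp add: h_u field_simps scaleR_conv_of_real)
      then show ?thesis by (simp add: norm_divide)
    qed
    then show "\<forall>\<^sub>F t in at 0. norm (u t - t *\<^sub>R D) / norm t = norm (h t - D)"
      by (auto simp: eventually_at intro!: exI[of _ 1])
  qed
  then have lim: "(h \<longlongrightarrow> D) (at 0)"
    by (simp add: tendsto_norm_zero_iff LIM_zero_iff)
  define H where "H = (\<lambda>t. if t = 0 then D else h t)"
  have "continuous_on {0..1} H"
    unfolding continuous_on_def
  proof
    fix t :: real assume t: "t \<in> {0..1}"
    show "(H \<longlongrightarrow> H t) (at t within {0..1})"
    proof (cases "t = 0")
      case True
      have "(H \<longlongrightarrow> D) (at 0)"
        using lim by (rule Lim_transform_eventually)
          (auto simp: H_def eventually_at intro!: exI[of _ 1])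
      then show ?thesis using True by (auto simp: H_def intro: filterlim_mono[OF _ order_refl at_le])
    next
      case False
      have "continuous_on {0<..1} h"
        unfolding h_def osc_kernel_def
        by (intro continuous_intros continuous_on_subset[OF cont] continuous_on_compose2[OF cont]) auto
      then have "(h \<longlongrightarrow> h t) (at t within {0<..1})"
        using t False by (auto simp: continuous_on_def)
      moreover have "at t within {0<..1} = at t within {0..1}"
        by (rule at_within_nhd[of t "{0<..}"]) (use t False in auto)
      ultimately have "(h \<longlongrightarrow> h t) (at t within {0..1})" by simp
      then have "(H \<longlongrightarrow> h t) (at t within {0..1})"
        by (rule Lim_transform_eventually)
           (use t False in \<open>auto simp: H_def eventually_at intro!: exI[of _ t]\<close>)
      then show ?thesis using False by (simp add: H_def)
    qed
  qed
  then have Hint: "H integrable_on {0..1}" by (rule integrable_continuous_real)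
  have "continuous_on {0..1} (\<lambda>x. integral {x..1} H)"
    by (rule indefinite_integral_continuous_1'[OF Hint])
  then have "((\<lambda>x. integral {x..1} H) \<longlongrightarrow> integral {0..1} H) (at 0 within {0..1})"
    by (auto simp: continuous_on_def)
  then have "((\<lambda>x. integral {x..1} H) \<longlongrightarrow> integral {0..1} H) (at_right 0)"
    by (simp add: at_within_Icc_at_right)
  moreover have ev: "eventually (\<lambda>x. 0 < x \<and> x \<le> (1::real)) (at_right 0)"
    unfolding eventually_at_right[OF zero_less_one] by (rule exI[of _ 1]) auto
  have "eventually (\<lambda>x. integral {x..1} H = integral {x..1} h) (at_right 0)"
    using ev by eventually_elim (auto intro!: integral_cong simp: H_def)
  ultimately have L: "((\<lambda>x. integral {x..1} h) \<longlongrightarrow> integral {0..1} H) (at_right 0)"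
    by (rule Lim_transform_eventually)
  have "eventually (\<lambda>x. integral {x..1} h = integral {t. x \<le> \<bar>t\<bar> \<and> \<bar>t\<bar> \<le> 1}
          (\<lambda>t. exp (\<i> * of_real (l * \<psi> t)) / of_real t)) (at_right 0)"
    using ev unfolding h_def by eventually_elim (rule pv_osc_truncation[OF _ _ cont, symmetric], auto)
  with L have "((\<lambda>x. integral {t. x \<le> \<bar>t\<bar> \<and> \<bar>t\<bar> \<le> 1}
          (\<lambda>t. exp (\<i> * of_real (l * \<psi> t)) / of_real t)) \<longlongrightarrow> integral {0..1} H) (at_right 0)"
    by (rule Lim_transform_eventually)
  then have "pv_osc \<psi> l = integral {0..1} H"
    unfolding pv_osc_def by (intro tendsto_Lim) auto
  with L show ?thesis by (simp add: h_def)
qed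

section \<open>The upper bound\<close>

text \<open>
  The basic splitting: below \<open>\<delta>\<close> the two sides cancel to the order \<open>m\<close> to which the phase is
  constant at 0; above \<open>\<delta>\<close> each side is estimated separately.
\<close>
lemma norm_pv_osc_le:
  assumes f: "derivative_chain {-1..1} f" and m: "m \<ge> 1"
    and van: "\<And>j. 1 \<le> j \<Longrightarrow> j < m \<Longrightarrow> f j 0 = 0"
    and B: "\<And>t. t \<in> {-1..1} \<Longrightarrow> \<bar>f m t\<bar> \<le> B"
    and \<delta>: "0 < \<delta>" "\<delta> \<le> 1" and l: "l \<ge> 0"
    and X: "norm (integral {\<delta>..1} (osc_kernel (f 0) l)) \<le> X"
    and Y: "norm (integral {\<delta>..1} (osc_kernel (\<lambda>t. f 0 (- t)) l)) \<le> Y"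
  shows "norm (pv_osc (f 0) l) \<le> l * (2 * B) * \<delta> ^ m + (X + Y)"
proof -
  let ?\<phi> = "\<lambda>t. f 0 (- t)"
  define h where "h n t = f n t - (-1) ^ n * f n (- t)" for n t
  have "derivative_chain {-1..1} h"
    using derivative_chainD[OF f] derivative_chainD[OF derivative_chain_reflect[OF f]]
    unfolding derivative_chain_def h_def by (intro allI ballI DERIV_diff) auto
  then have h: "derivative_chain {0..1} h" by (rule derivative_chain_subset) auto
  have B0: "B \<ge> 0" using B[of 0] by auto
  have hB: "\<bar>h m t\<bar> \<le> 2 * B" if "t \<in> {0..1}" for t
  proof -
    have "\<bar>h m t\<bar> \<le> \<bar>f m t\<bar> + \<bar>(-1) ^ m * f m (- t)\<bar>" unfolding h_def by (rule abs_triangle_ineq4)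
    also have "\<dots> \<le> 2 * B" using B[of t] B[of "- t"] that by (auto simp: abs_mult power_abs)
    finally show ?thesis .
  qed
  have h0: "h j 0 = 0" if "0 \<le> j" "j < m" for j
    using van[of j] that by (cases j) (auto simp: h_def)
  have diff: "\<bar>f 0 t - f 0 (- t)\<bar> \<le> 2 * B * t ^ m" if "t \<in> {0..1}" for t
    using vanishing_derivatives_upper[OF h hB h0, where j = 0] that by (simp add: h_def)
  have c: "continuous_on {a..1} (f 0)" "continuous_on {a..1} ?\<phi>" if "a > 0" for a
    using that derivative_chain_continuous_on[OF f, of 0]
    by (auto intro!: continuous_on_subset[of "{-1..1}" "f 0"]
          continuous_on_compose2[of "{-1..1}" "f 0"] continuous_intros)
  have bound: "norm (integral {\<epsilon>..1} (\<lambda>t. osc_kernel (f 0) l t - osc_kernel ?\<phi> l t))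
      \<le> l * (2 * B) * \<delta> ^ m + (X + Y)" if \<epsilon>: "0 < \<epsilon>" "\<epsilon> < \<delta>" for \<epsilon>
  proof -
    let ?k = "\<lambda>t. osc_kernel (f 0) l t - osc_kernel ?\<phi> l t"
    have "?k integrable_on {\<epsilon>..1}"
      using \<epsilon> c[of \<epsilon>] by (intro integrable_diff osc_kernel_integrable) auto
    then have "integral {\<epsilon>..1} ?k = integral {\<epsilon>..\<delta>} ?k + integral {\<delta>..1} ?k"
      using Henstock_Kurzweil_Integration.integral_combine[where a = \<epsilon> and c = \<delta> and b = 1 and f = ?k] \<epsilon> \<delta> by simp
    also have "integral {\<delta>..1} ?k = integral {\<delta>..1} (osc_kernel (f 0) l) - integral {\<delta>..1} (osc_kernel ?\<phi> l)"
      using \<delta> c[of \<delta>] by (intro integral_diff osc_kernel_integrable) auto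
    finally have "norm (integral {\<epsilon>..1} ?k) \<le> norm (integral {\<epsilon>..\<delta>} ?k) +
        (norm (integral {\<delta>..1} (osc_kernel (f 0) l)) + norm (integral {\<delta>..1} (osc_kernel ?\<phi> l)))"
      by (smt (verit) norm_triangle_ineq norm_triangle_ineq4)
    moreover have "norm (integral {\<epsilon>..\<delta>} ?k) \<le> l * (2 * B) * \<delta> ^ m"
      using \<epsilon> \<delta> l B0 m diff c[of \<epsilon>]
      by (intro norm_integral_osc_kernel_diff_le) (auto intro: continuous_on_subset)
    ultimately show ?thesis using X Y by linarith
  qed
  have "((\<lambda>\<epsilon>. norm (integral {\<epsilon>..1} (\<lambda>t. osc_kernel (f 0) l t - osc_kernel ?\<phi> l t)))
      \<longlongrightarrow> norm (pv_osc (f 0) l)) (at_right 0)"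
    by (intro tendsto_norm tendsto_pv_osc[OF derivative_chainD[OF f]])
  moreover have "\<forall>\<^sub>F \<epsilon> in at_right 0. norm (integral {\<epsilon>..1} (\<lambda>t. osc_kernel (f 0) l t - osc_kernel ?\<phi> l t))
      \<le> l * (2 * B) * \<delta> ^ m + (X + Y)"
    unfolding eventually_at_right[OF \<delta>(1)] using bound \<delta>(1) by (auto intro!: exI[of _ \<delta>])
  ultimately show ?thesis by (rule tendsto_upperbound) simp
qed

text \<open>
  If \<open>f 0\<close> has order of contact exactly \<open>m\<close> with a constant, then \<open>t f 1 t\<close> is comparable
  to \<open>t ^ m\<close> and \<open>g = 1 / (t f 1 t)\<close> has derivative \<open>O(t ^ (- m - 1))\<close>, so integration by parts
  gives a bound as soon as \<open>l \<delta> ^ m \<ge> 1\<close>. Away from 0 the trivial logarithmic bound is enough.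
\<close>
lemma norm_integral_osc_kernel_finite_order:
  assumes f: "derivative_chain {0..1} f" and m: "m \<ge> 1"
    and van: "\<And>j. 1 \<le> j \<Longrightarrow> j < m \<Longrightarrow> f j 0 = 0" and nz: "f m 0 \<noteq> 0"
  shows "\<exists>C. \<forall>l>0. \<forall>\<delta>. 0 < \<delta> \<longrightarrow> \<delta> \<le> 1 \<longrightarrow> 1 \<le> l * \<delta> ^ m \<longrightarrow>
           norm (integral {\<delta>..1} (osc_kernel (f 0) l)) \<le> C"
proof -
  have cont: "continuous_on {0..1} (f n)" for n by (rule derivative_chain_continuous_on[OF f])
  have "\<exists>B. \<forall>t\<in>{0..1}. \<bar>f n t\<bar> \<le> B" for n
    using compact_imp_bounded[OF compact_continuous_image[OF cont[of n]]]
    by (auto simp: bounded_iff)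
  then obtain B1 B2 where B12: "\<And>t. t \<in> {0..1} \<Longrightarrow> \<bar>f m t\<bar> \<le> B1"
    "\<And>t. t \<in> {0..1} \<Longrightarrow> \<bar>f (Suc m) t\<bar> \<le> B2" by metis
  define B where "B = max B1 B2"
  have B: "\<bar>f m t\<bar> \<le> B" "\<bar>f (Suc m) t\<bar> \<le> B" if "t \<in> {0..1}" for t
    using B12[OF that] by (auto simp: B_def)
  have B0: "B \<ge> 0" using B(1)[of 0] by auto
  define \<sigma> where "\<sigma> = sgn (f m 0)"
  define b where "b = \<bar>f m 0\<bar> / 2"
  have b: "b > 0" using nz by (simp add: b_def)
  have \<sigma>: "\<bar>\<sigma>\<bar> = 1" "\<sigma> * f m 0 = 2 * b" using nz by (auto simp: \<sigma>_def b_def abs_sgn mult.commute)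
  obtain d where d: "d > 0" "\<And>t. t \<in> {0..1} \<Longrightarrow> dist t 0 < d \<Longrightarrow> dist (f m t) (f m 0) < b"
    using cont[of m] b unfolding continuous_on_iff by (metis atLeastAtMost_iff order_refl zero_le_one)
  define r where "r = min 1 (d / 2)"
  have r: "0 < r" "r \<le> 1" "r < d" using d by (auto simp: r_def)
  have low_m: "b \<le> \<sigma> * f m t" if t: "t \<in> {0..r}" for t
  proof -
    have "\<bar>f m t - f m 0\<bar> < b" using d(2)[of t] t r by (auto simp: dist_real_def)
    then have "\<bar>\<sigma> * (f m t - f m 0)\<bar> < b" by (simp add: abs_mult \<sigma>)
    then show ?thesis using \<sigma>(2) by (simp add: algebra_simps)
  qed
  define \<beta> where "\<beta> = b / fact (m - 1)"
  have \<beta>: "\<beta> > 0" using b by (simp add: \<beta>_def)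
  have low: "\<beta> * t ^ (m - 1) \<le> \<bar>f 1 t\<bar>" if t: "t \<in> {0..r}" for t
  proof -
    have "b * t ^ (m - 1) / fact (m - 1) \<le> \<sigma> * f 1 t"
      using vanishing_derivatives_lower[OF f r(2) low_m van, where j = 1] m t by simp
    also have "\<dots> \<le> \<bar>f 1 t\<bar>" using \<sigma>(1) by (metis abs_ge_self abs_mult mult_1)
    finally show ?thesis by (simp add: \<beta>_def)
  qed
  have up1: "\<bar>f 1 t\<bar> \<le> B * t ^ (m - 1)" if "t \<in> {0..1}" for t
    using vanishing_derivatives_upper[OF f B(1) van, where j = 1] m that by simp
  have up2: "\<bar>t * f 2 t\<bar> \<le> B * t ^ (m - 1)" if t: "t \<in> {0..1}" for t
  proof (cases "m = 1")
    case True
    have "\<bar>t\<bar> * \<bar>f 2 t\<bar> \<le> 1 * B" using B(2)[of t] t True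
      by (intro mult_mono) (auto simp: numeral_2_eq_2)
    then show ?thesis using True by (simp add: abs_mult)
  next
    case False
    then have m2: "2 \<le> m" using m by simp
    have van2: "f j 0 = 0" if "2 \<le> j" "j < m" for j using van that by simp
    have "\<bar>f 2 t\<bar> \<le> B * t ^ (m - 2)"
      using vanishing_derivatives_upper[OF f B(1) van2, where j = 2] m2 t by simp
    then have "\<bar>t\<bar> * \<bar>f 2 t\<bar> \<le> t * (B * t ^ (m - 2))"
      using t by (intro mult_mono) auto
    also have "\<dots> = B * t ^ (m - 1)"
    proof -
      have "m - 1 = Suc (m - 2)" using m2 by simp
      then show ?thesis by (simp only: power_Suc mult.left_commute)
    qed
    finally show ?thesis by (simp add: abs_mult)
  qed
  \<comment> \<open>\<open>Q\<close> is chosen so that \<open>Q / t ^ m\<close> has the derivative \<open>- 2 B t ^ (m - 1) / (\<beta> t ^ m)^2\<close>.\<close>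
  define Q where "Q = 2 * B / \<beta>\<^sup>2 / m"
  \<comment> \<open>\<open>- ln r\<close> pays for the interval \<open>{r..1}\<close>, where nothing is known about \<open>f 1\<close>.\<close>
  define C where "C = 2 / \<beta> + Q - ln r"
  have Q0: "Q \<ge> 0" using B0 by (simp add: Q_def)
  have tm: "t * t ^ (m - 1) = t ^ m" for t :: real using m by (simp add: power_eq_if)
  have main: "norm (integral {\<delta>..r} (osc_kernel (f 0) l)) \<le> 2 / \<beta> + Q"
    if l: "l > 0" and \<delta>: "0 < \<delta>" "\<delta> \<le> r" "1 \<le> l * \<delta> ^ m" for l \<delta>
  proof -
    define g where "g t = 1 / (t * f 1 t)" for t
    define g' where "g' t = - (f 1 t + t * f 2 t) / (t * f 1 t)\<^sup>2" for t
    define G where "G t = Q / t ^ m" for t :: real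
    define G' where "G' t = - (Q * m * t ^ (m - 1)) / (t ^ m)\<^sup>2" for t :: real
    have low_tf: "\<beta> * t ^ m \<le> \<bar>t * f 1 t\<bar>" if "t \<in> {\<delta>..r}" for t
    proof -
      have "t * (\<beta> * t ^ (m - 1)) \<le> t * \<bar>f 1 t\<bar>"
        using that \<delta> low[of t] by (intro mult_left_mono) auto
      then show ?thesis using that \<delta> tm[of t] by (simp add: abs_mult mult.left_commute)
    qed
    have nz: "t * f 1 t \<noteq> 0" if "t \<in> {\<delta>..r}" for t
    proof -
      have "0 < \<beta> * t ^ m" using \<beta> that \<delta> by simp
      with low_tf[OF that] show ?thesis by auto
    qed
    have g_le: "\<bar>g t\<bar> \<le> 1 / (\<beta> * \<delta> ^ m)" if "t \<in> {\<delta>..r}" for t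
    proof -
      have "\<beta> * \<delta> ^ m \<le> \<beta> * t ^ m" using that \<delta> \<beta> by (intro mult_left_mono power_mono) auto
      with low_tf[OF that] have "\<beta> * \<delta> ^ m \<le> \<bar>t * f 1 t\<bar>" by linarith
      then show ?thesis using \<beta> \<delta> nz[OF that]
        by (simp add: g_def abs_mult) (intro divide_left_mono; simp add: abs_mult)
    qed
    have "norm (integral {\<delta>..r} (osc_kernel (f 0) l)) \<le> (\<bar>g \<delta>\<bar> + \<bar>g r\<bar> + (G \<delta> - G r)) / l"
    proof (rule norm_integral_osc_kernel_by_parts[OF \<delta>(1,2) l])
      fix t assume t: "t \<in> {\<delta>..r}"
      have der: "(f n has_real_derivative f (Suc n) t) (at t within {\<delta>..r})" for n
        using derivative_chainD[OF derivative_chain_subset[OF f, of "{\<delta>..r}"] t] \<delta> r by auto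
      show "(f 0 has_real_derivative f 1 t) (at t within {\<delta>..r})" using der[of 0] by simp
      show "(g has_real_derivative g' t) (at t within {\<delta>..r})"
        unfolding g_def g'_def using nz[OF t] der[of 1]
        by (auto intro!: derivative_eq_intros simp: power2_eq_square numeral_2_eq_2)
      show "(G has_real_derivative G' t) (at t within {\<delta>..r})"
        unfolding G_def G'_def using t \<delta>(1)
        by (auto intro!: derivative_eq_intros simp: power2_eq_square)
      show "g t * (t * f 1 t) = 1" using nz[OF t] by (simp add: g_def)
      have "\<bar>g' t\<bar> = \<bar>f 1 t + t * f 2 t\<bar> / \<bar>t * f 1 t\<bar>\<^sup>2"
        by (simp only: g'_def abs_divide abs_minus_cancel abs_power2 power2_abs)
      also have "\<dots> \<le> (2 * B * t ^ (m - 1)) / (\<beta> * t ^ m)\<^sup>2"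
      proof (rule frac_le)
        show "\<bar>f 1 t + t * f 2 t\<bar> \<le> 2 * B * t ^ (m - 1)"
          using up1[of t] up2[of t] t \<delta> r by auto
        show "(\<beta> * t ^ m)\<^sup>2 \<le> \<bar>t * f 1 t\<bar>\<^sup>2"
          using low_tf[OF t] \<beta> t \<delta> by (intro power_mono) auto
      qed (use B0 \<beta> t \<delta> in auto)
      also have "\<dots> = - G' t" using m \<beta> by (simp add: G'_def Q_def power_mult_distrib)
      finally show "\<bar>g' t\<bar> \<le> - G' t" .
    qed
    also have "\<dots> \<le> (1 / (\<beta> * \<delta> ^ m) + 1 / (\<beta> * \<delta> ^ m) + Q / \<delta> ^ m) / l"
    proof -
      have "0 \<le> G r" using Q0 r by (simp add: G_def)
      then show ?thesis using g_le[of \<delta>] g_le[of r] \<delta> l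
        by (intro divide_right_mono) (auto simp: G_def)
    qed
    also have "\<dots> = (2 / \<beta> + Q) / (l * \<delta> ^ m)"
      using \<beta> \<delta> l by (simp add: field_simps)
    also have "\<dots> \<le> (2 / \<beta> + Q) / 1"
      using \<delta> \<beta> Q0 by (intro divide_left_mono) auto
    finally show ?thesis by simp
  qed
  have "norm (integral {\<delta>..1} (osc_kernel (f 0) l)) \<le> C"
    if l: "l > 0" and \<delta>: "0 < \<delta>" "\<delta> \<le> 1" "1 \<le> l * \<delta> ^ m" for l \<delta>
  proof (cases "\<delta> \<le> r")
    case True
    have c: "continuous_on {\<delta>..1} (f 0)" "continuous_on {r..1} (f 0)"
      using \<delta> r by (auto intro!: continuous_on_subset[OF cont])
    have "integral {\<delta>..1} (osc_kernel (f 0) l)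
        = integral {\<delta>..r} (osc_kernel (f 0) l) + integral {r..1} (osc_kernel (f 0) l)"
      using Henstock_Kurzweil_Integration.integral_combine[OF True r(2) osc_kernel_integrable[OF \<delta>(1) c(1)]] by simp
    then have "norm (integral {\<delta>..1} (osc_kernel (f 0) l))
        \<le> norm (integral {\<delta>..r} (osc_kernel (f 0) l)) + norm (integral {r..1} (osc_kernel (f 0) l))"
      by (simp add: norm_triangle_ineq)
    also have "\<dots> \<le> C"
      using main[OF l \<delta>(1) True \<delta>(3)] norm_integral_osc_kernel_le_ln[OF r(1,2) c(2), of l]
      by (simp add: C_def)
    finally show ?thesis .
  next
    case False
    have "norm (integral {\<delta>..1} (osc_kernel (f 0) l)) \<le> ln 1 - ln \<delta>"
      using \<delta> by (intro norm_integral_osc_kernel_le_ln continuous_on_subset[OF cont]) auto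
    also have "\<dots> \<le> - ln r" using False \<delta> r by (auto simp: ln_le_cancel_iff)
    also have "\<dots> \<le> C" using \<beta> Q0 by (simp add: C_def)
    finally show ?thesis .
  qed
  then show ?thesis by blast
qed

text \<open>
  A phase that is not flat at 0 gives a bounded principal value: cutting at \<open>\<delta> = l powr (- 1 / k)\<close>,
  where \<open>k\<close> is the order of the first derivative that does not vanish, balances the cancellation below
  \<open>\<delta>\<close> against the oscillation above it.
\<close>
lemma pv_osc_bounded_finite_order:
  assumes f: "derivative_chain {-1..1} f" and nz: "m \<ge> 1" "f m 0 \<noteq> 0"
  shows "\<exists>C. \<forall>l\<ge>1. norm (pv_osc (f 0) l) \<le> C"
proof -
  define k where "k = (LEAST j. 1 \<le> j \<and> f j 0 \<noteq> 0)"
  have k: "1 \<le> k" "f k 0 \<noteq> 0"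
    using LeastI[of "\<lambda>j. 1 \<le> j \<and> f j 0 \<noteq> 0" m] nz by (auto simp: k_def)
  have van: "f j 0 = 0" if "1 \<le> j" "j < k" for j
    using not_less_Least[of j "\<lambda>j. 1 \<le> j \<and> f j 0 \<noteq> 0"] that by (auto simp: k_def)
  define g where "g n t = (-1) ^ n * f n (- t)" for n t
  have g: "derivative_chain {-1..1} g"
    unfolding g_def by (rule derivative_chain_reflect[OF f])
  have g0: "g j 0 = 0" if "1 \<le> j" "j < k" for j using van that by (simp add: g_def)
  have g_0: "g 0 = (\<lambda>t. f 0 (- t))" by (simp add: g_def fun_eq_iff)
  have gk: "g k 0 \<noteq> 0" using k by (simp add: g_def)
  have sub: "{0..1} \<subseteq> {-1..1::real}" by auto
  obtain C1 where C1: "\<forall>l>0. \<forall>\<delta>. 0 < \<delta> \<longrightarrow> \<delta> \<le> 1 \<longrightarrow> 1 \<le> l * \<delta> ^ k \<longrightarrow>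
      norm (integral {\<delta>..1} (osc_kernel (f 0) l)) \<le> C1"
    using norm_integral_osc_kernel_finite_order[OF derivative_chain_subset[OF f sub] k(1) van k(2)]
    by blast
  obtain C2 where C2: "\<forall>l>0. \<forall>\<delta>. 0 < \<delta> \<longrightarrow> \<delta> \<le> 1 \<longrightarrow> 1 \<le> l * \<delta> ^ k \<longrightarrow>
      norm (integral {\<delta>..1} (osc_kernel (g 0) l)) \<le> C2"
    using norm_integral_osc_kernel_finite_order[OF derivative_chain_subset[OF g sub] k(1) g0 gk]
    by blast
  have "\<exists>B. \<forall>t\<in>{-1..1}. \<bar>f k t\<bar> \<le> B"
    using compact_imp_bounded[OF compact_continuous_image[OF derivative_chain_continuous_on[OF f], of k]]
    by (auto simp: bounded_iff)
  then obtain B where B: "\<And>t. t \<in> {-1..1} \<Longrightarrow> \<bar>f k t\<bar> \<le> B" by blast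
  have "norm (pv_osc (f 0) l) \<le> 2 * B + (C1 + C2)" if l: "l \<ge> 1" for l
  proof -
    define \<delta> where "\<delta> = l powr (- 1 / k)"
    have "\<delta> ^ k = l powr (- 1)"
      using l k by (simp add: \<delta>_def powr_realpow[symmetric] powr_powr)
    then have \<delta>k: "l * \<delta> ^ k = 1" using l by (simp add: powr_minus_divide)
    have \<delta>: "0 < \<delta>" "\<delta> \<le> 1" using l powr_mono[of "- 1 / k" 0 l] by (auto simp: \<delta>_def)
    have "norm (pv_osc (f 0) l) \<le> l * (2 * B) * \<delta> ^ k + (C1 + C2)"
      using l \<delta> \<delta>k C1[rule_format, of l \<delta>] C2[rule_format, of l \<delta>]
      by (intro norm_pv_osc_le[OF f k(1) van B]) (auto simp: g_0)
    also have "l * (2 * B) * \<delta> ^ k = 2 * B"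
      using \<delta>k by (metis mult.assoc mult.commute mult_1)
    finally show ?thesis .
  qed
  then show ?thesis by blast
qed

text \<open>
  For a flat phase every order of cancellation is available, at the price \<open>K ^ (n + 1) exp (c n powr \<alpha>)\<close>. With
  \<open>N = (ln l) powr (1 / \<alpha>)\<close> and \<open>n\<close> the least integer not below \<open>N\<close>, the weight \<open>exp (c n powr \<alpha>)\<close> is
  at most a power of \<open>l\<close>, and the cut-off \<open>\<delta> = exp (- D N powr (\<alpha> - 1)) / K\<close> compensates it since
  \<open>(K \<delta>) ^ n\<close> is at most \<open>l powr (- D)\<close>. What remains is the trivial bound \<open>2 ln (1 / \<delta>)\<close>, of
  order \<open>N powr (\<alpha> - 1) = (ln l) powr (1 - 1 / \<alpha>)\<close>.
\<close>
lemma norm_pv_osc_le_of_flat: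
  assumes f: "derivative_chain {-1..1} f" and flat: "\<And>j. j \<ge> 1 \<Longrightarrow> f j 0 = 0"
    and \<alpha>: "\<alpha> > 1" and c: "c > 0" and K: "K \<ge> 1"
    and bound: "\<And>n t. t \<in> {-1..1} \<Longrightarrow> \<bar>f n t\<bar> \<le> K ^ (n + 1) * exp (c * real n powr \<alpha>)"
    and l: "l \<ge> exp 1"
  shows "norm (pv_osc (f 0) l)
    \<le> (2 * K + 2 * (1 + c * 2 powr \<alpha>) + 2 * ln K) * ln l powr (1 - 1 / \<alpha>)"
proof -
  have l0: "l > 0" using l exp_gt_zero[of 1] by linarith
  then have lnl: "ln l \<ge> 1" using l by (simp add: ln_ge_iff)
  define N where "N = ln l powr (1 / \<alpha>)"
  define Y where "Y = ln l powr (1 - 1 / \<alpha>)"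
  \<comment> \<open>\<open>D\<close> absorbs both the factor \<open>l\<close> and the weight, which is at most \<open>l powr (c 2 powr \<alpha>)\<close>
      because \<open>n \<le> 2 N\<close>.\<close>
  define D where "D = 1 + c * 2 powr \<alpha>"
  define n where "n = nat \<lceil>N\<rceil>"
  define \<delta> where "\<delta> = exp (- D * Y) / K"
  have N1: "N \<ge> 1" using lnl \<alpha> by (simp add: N_def ge_one_powr_ge_zero)
  have Y1: "Y \<ge> 1" using lnl \<alpha> by (simp add: Y_def ge_one_powr_ge_zero)
  have NY: "N * Y = ln l" using lnl by (simp add: N_def Y_def powr_add[symmetric])
  have Na: "N powr \<alpha> = ln l" using lnl \<alpha> by (simp add: N_def powr_powr)
  have D1: "D \<ge> 1" using c by (simp add: D_def)
  have n: "1 \<le> n" "N \<le> n" "n \<le> 2 * N" using N1 ceiling_correct[of N] by (auto simp: n_def le_nat_iff)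
  have \<delta>: "0 < \<delta>" "\<delta> \<le> 1"
  proof -
    have "exp (- D * Y) \<le> 1" using D1 Y1 by simp
    then have "exp (- D * Y) \<le> K" using K by linarith
    then show "0 < \<delta>" "\<delta> \<le> 1" using K by (auto simp: \<delta>_def divide_le_eq_1_pos)
  qed
  have ln\<delta>: "ln 1 - ln \<delta> = D * Y + ln K" using K by (simp add: \<delta>_def ln_div)
  have triv: "norm (integral {\<delta>..1} (osc_kernel h l)) \<le> D * Y + ln K"
    if "continuous_on {-1..1} h" for h
    using norm_integral_osc_kernel_le_ln[OF \<delta>, of h l] continuous_on_subset[OF that, of "{\<delta>..1}"] \<delta> ln\<delta>
    by auto
  have cf: "continuous_on {-1..1} (f 0)" by (rule derivative_chain_continuous_on[OF f])
  have cg: "continuous_on {-1..1} (\<lambda>t. f 0 (- t))"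
    by (rule continuous_on_compose2[OF cf]) (auto intro!: continuous_intros)
  define B where "B = K ^ (n + 1) * exp (c * real n powr \<alpha>)"
  have "norm (pv_osc (f 0) l) \<le> l * (2 * B) * \<delta> ^ n + ((D * Y + ln K) + (D * Y + ln K))"
    using n flat bound \<delta> l0
    by (intro norm_pv_osc_le[OF f] triv cf cg) (auto simp: B_def)
  also have "l * (2 * B) * \<delta> ^ n \<le> 2 * K"
  proof -
    have "\<delta> ^ n = exp (- D * Y * n) / K ^ n"
      by (simp add: \<delta>_def power_divide exp_of_nat2_mult[symmetric] mult_ac)
    then have "l * (2 * B) * \<delta> ^ n = 2 * K * (l * exp (c * real n powr \<alpha>) * exp (- D * Y * n))"
      using K by (simp add: B_def)
    also have "l * exp (c * real n powr \<alpha>) * exp (- D * Y * n)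
        = exp (ln l + c * real n powr \<alpha> - D * Y * n)"
      using l0 by (simp add: exp_add exp_diff exp_minus divide_inverse)
    also have "\<dots> \<le> exp 0"
    proof -
      have "real n powr \<alpha> \<le> (2 * N) powr \<alpha>" using n \<alpha> by (intro powr_mono2) auto
      also have "\<dots> = 2 powr \<alpha> * ln l" using N1 by (simp add: powr_mult Na)
      finally have 1: "c * real n powr \<alpha> \<le> c * (2 powr \<alpha> * ln l)" using c by simp
      have "D * Y * N \<le> D * Y * n" using D1 Y1 n by (intro mult_left_mono) auto
      moreover have "D * Y * N = D * ln l" using NY by (simp add: mult_ac)
      ultimately show ?thesis using 1 by (simp add: D_def algebra_simps)
    qed
    finally show ?thesis using K by simp
  qed
  finally have "norm (pv_osc (f 0) l) \<le> (2 * K + 2 * ln K) + 2 * D * Y" by simp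
  also have "\<dots> \<le> (2 * K + 2 * ln K) * Y + 2 * D * Y"
    using Y1 K mult_left_mono[OF Y1, of "2 * K + 2 * ln K"] by simp
  finally show ?thesis by (simp add: Y_def D_def algebra_simps)
qed

text \<open>
  Either all derivatives of the phase of positive order vanish at 0 or one of them does not; the two
  cases are covered by the two preceding lemmas.
\<close>
theorem carleman_class_pv_osc_bigo:
  assumes \<alpha>: "\<alpha> > 1" and c: "c > 0" and M: "\<And>n. M n = exp (c * real n powr \<alpha>)"
    and \<psi>: "\<psi> \<in> carleman_class M {-1..1}"
  shows "(\<lambda>l. norm (pv_osc \<psi> l)) \<in> O[at_top](\<lambda>l. ln l powr (1 - 1 / \<alpha>))"
proof -
  obtain f K where f: "f 0 = \<psi>" "derivative_chain {-1..1} f" "K \<ge> 1"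
    "\<And>n t. t \<in> {-1..1} \<Longrightarrow> \<bar>f n t\<bar> \<le> K ^ (n + 1) * M n"
    using carleman_class_derivative_chain[OF \<psi>] M by (metis exp_ge_zero)
  have ex: "\<exists>C. \<forall>l\<ge>exp 1. norm (pv_osc \<psi> l) \<le> C * ln l powr (1 - 1 / \<alpha>)"
  proof (cases "\<forall>j\<ge>1. f j 0 = 0")
    case True
    then show ?thesis
      using norm_pv_osc_le_of_flat[OF f(2) _ \<alpha> c f(3) f(4)[unfolded M]] f(1) by blast
  next
    case False
    then obtain C where C: "\<And>l. l \<ge> 1 \<Longrightarrow> norm (pv_osc \<psi> l) \<le> C"
      using pv_osc_bounded_finite_order[OF f(2)] f(1) by blast
    have C0: "0 \<le> C" using C[of 1] norm_ge_zero order_trans by blast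
    have "norm (pv_osc \<psi> l) \<le> C * ln l powr (1 - 1 / \<alpha>)" if l: "l \<ge> exp 1" for l
    proof -
      have l1: "l \<ge> 1" using l exp_ge_add_one_self[of "1::real"] by linarith
      then have "ln l \<ge> 1" using l by (simp add: ln_ge_iff)
      then have "1 \<le> ln l powr (1 - 1 / \<alpha>)" using \<alpha> by (simp add: ge_one_powr_ge_zero)
      then show ?thesis using C[OF l1] C0 mult_left_mono[of 1 _ C] by fastforce
    qed
    then show ?thesis by blast
  qed
  then obtain C where "\<And>l. l \<ge> exp 1 \<Longrightarrow> norm (pv_osc \<psi> l) \<le> C * ln l powr (1 - 1 / \<alpha>)" by blast
  then show ?thesis
    by (intro bigoI[of _ C]) (auto simp: eventually_at_top_linorder intro!: exI[of _ "exp 1"])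
qed

section \<open>A lower bound for one-sided convex phases\<close>

text \<open>
  If the phase vanishes to the left of 0, then the left half of the integral does not oscillate and
  contributes \<open>- (ln 1 - ln \<delta>)\<close> from \<open>t \<ge> \<delta>\<close>, which nothing on the right can cancel: there convexity
  makes \<open>1 / (t f 1 t)\<close> decreasing, so that integration by parts bounds the oscillating half by
  \<open>2 / q\<close>. For \<open>t < \<delta>\<close> the real part \<open>(cos (l f 0 t) - 1) / t\<close> of the combined
  integrand is at most 0, so that this range only adds to the negative real part.
\<close>
lemma norm_pv_osc_ge:
  assumes f: "derivative_chain {-1..1} f"
    and left: "\<And>t. t \<in> {-1..0} \<Longrightarrow> f 0 t = 0"
    and convex: "\<And>t. t \<in> {0..1} \<Longrightarrow> 0 \<le> f 2 t"
    and \<delta>: "0 < \<delta>" "\<delta> \<le> 1" and l: "l > 0" and q: "q > 0" "q \<le> l * (\<delta> * f 1 \<delta>)"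
  shows "- ln \<delta> - 2 / q \<le> norm (pv_osc (f 0) l)"
proof -
  let ?\<phi> = "\<lambda>t. f 0 (- t)"
  let ?k = "\<lambda>t. osc_kernel (f 0) l t - osc_kernel ?\<phi> l t"
  have f1\<delta>: "0 < f 1 \<delta>"
  proof -
    have "0 < l * \<delta> * f 1 \<delta>" using q by (simp add: mult.assoc)
    then show ?thesis by (rule zero_less_mult_pos) (use l \<delta> in simp)
  qed
  have der: "(f n has_real_derivative f (Suc n) t) (at t within {\<delta>..1})" if "t \<in> {\<delta>..1}" for n t
    using derivative_chainD[OF derivative_chain_subset[OF f]] that \<delta> by auto
  have f1: "f 1 \<delta> \<le> f 1 t" if t: "t \<in> {\<delta>..1}" for t
  proof (rule DERIV_nonneg_imp_increasing_open[where f = "f 1"])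
    show "\<delta> \<le> t" using t by simp
    show "continuous_on {\<delta>..t} (f 1)"
      using t \<delta> by (intro continuous_on_subset[OF derivative_chain_continuous_on[OF f]]) auto
    show "\<exists>y. (f 1 has_real_derivative y) (at x) \<and> 0 \<le> y" if "\<delta> < x" "x < t" for x
      using der[of x 1] convex[of x] that t \<delta> by (auto simp: at_within_Icc_at numeral_2_eq_2)
  qed
  have f1_pos: "0 < f 1 t" if "t \<in> {\<delta>..1}" for t using f1[OF that] f1\<delta> by linarith
  define g where "g t = 1 / (t * f 1 t)" for t
  define g' where "g' t = - (f 1 t + t * f 2 t) / (t * f 1 t)\<^sup>2" for t
  have nz: "t * f 1 t > 0" if "t \<in> {\<delta>..1}" for t using f1_pos[OF that] that \<delta> by simp
  have g: "(g has_real_derivative g' t) (at t within {\<delta>..1})" if t: "t \<in> {\<delta>..1}" for t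
    unfolding g_def g'_def using less_imp_neq[OF nz[OF t]] der[OF t, of 1]
    by (auto intro!: derivative_eq_intros simp: power2_eq_square numeral_2_eq_2)
  have "norm (integral {\<delta>..1} (osc_kernel (f 0) l)) \<le> (\<bar>g \<delta>\<bar> + \<bar>g 1\<bar> + (g \<delta> - g 1)) / l"
  proof (rule norm_integral_osc_kernel_by_parts[OF \<delta> l _ g g])
    fix t assume t: "t \<in> {\<delta>..1}"
    show "(f 0 has_real_derivative f 1 t) (at t within {\<delta>..1})" using der[OF t, of 0] by simp
    show "g t * (t * f 1 t) = 1" using less_imp_neq[OF nz[OF t]] by (simp add: g_def)
    have "0 \<le> t * f 2 t" using convex[of t] t \<delta> by simp
    then have "g' t \<le> 0"
      unfolding g'_def using f1_pos[OF t] by (intro divide_nonpos_nonneg) auto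
    then show "\<bar>g' t\<bar> \<le> - g' t" by simp
  qed
  also have "\<dots> = 2 / (l * (\<delta> * f 1 \<delta>))"
    using nz[of \<delta>] nz[of 1] \<delta> l by (simp add: g_def)
  also have "\<dots> \<le> 2 / q" using q by (intro divide_left_mono) auto
  finally have osc: "norm (integral {\<delta>..1} (osc_kernel (f 0) l)) \<le> 2 / q" .
  have c: "continuous_on {a..1} (f 0)" "continuous_on {a..1} ?\<phi>" if "a > 0" for a
    using that derivative_chain_continuous_on[OF f, of 0]
    by (auto intro!: continuous_on_subset[of "{-1..1}" "f 0"]
          continuous_on_compose2[of "{-1..1}" "f 0"] continuous_intros)
  have \<phi>: "osc_kernel ?\<phi> l t = of_real (1 / t)" if "t \<in> {0..1}" for t
    using left[of "- t"] that by (simp add: osc_kernel_def)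
  have "((\<lambda>t. 1 / t) has_integral ln 1 - ln \<delta>) {\<delta>..1}"
    using \<delta>
    by (intro fundamental_theorem_of_calculus)
       (auto simp: has_real_derivative_iff_has_vector_derivative[symmetric]
             intro!: derivative_eq_intros)
  then have "((\<lambda>t. complex_of_real (1 / t)) has_integral of_real (ln 1 - ln \<delta>)) {\<delta>..1}"
    by (rule has_integral_of_real)
  then have "(osc_kernel ?\<phi> l has_integral of_real (ln 1 - ln \<delta>)) {\<delta>..1}"
    by (rule has_integral_eq[rotated]) (use \<phi> \<delta> in auto)
  then have int\<phi>: "integral {\<delta>..1} (osc_kernel ?\<phi> l) = of_real (- ln \<delta>)"
    by (simp add: integral_unique)
  have bound: "- ln \<delta> - 2 / q \<le> norm (integral {\<epsilon>..1} ?k)" if \<epsilon>: "0 < \<epsilon>" "\<epsilon> < \<delta>" for \<epsilon>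
  proof -
    have ik: "?k integrable_on {\<epsilon>..1}"
      using \<epsilon> c[of \<epsilon>] by (intro integrable_diff osc_kernel_integrable) auto
    then have ik': "?k integrable_on {\<epsilon>..\<delta>}"
      by (rule integrable_subinterval_real) (use \<epsilon> \<delta> in auto)
    have "integral {\<epsilon>..1} ?k = integral {\<epsilon>..\<delta>} ?k + integral {\<delta>..1} ?k"
      using Henstock_Kurzweil_Integration.integral_combine[where a = \<epsilon> and c = \<delta> and b = 1 and f = ?k]
        ik \<epsilon> \<delta> by simp
    also have "integral {\<delta>..1} ?k = integral {\<delta>..1} (osc_kernel (f 0) l) - of_real (- ln \<delta>)"
      unfolding int\<phi>[symmetric] using \<delta> c[of \<delta>] by (intro integral_diff osc_kernel_integrable) auto
    finally have "Re (integral {\<epsilon>..1} ?k) = Re (integral {\<epsilon>..\<delta>} ?k)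
        + Re (integral {\<delta>..1} (osc_kernel (f 0) l)) + ln \<delta>" by simp
    moreover have "Re (integral {\<epsilon>..\<delta>} ?k) \<le> 0"
    proof -
      have int: "((Re \<circ> ?k) has_integral Re (integral {\<epsilon>..\<delta>} ?k)) {\<epsilon>..\<delta>}"
        by (rule has_integral_linear[OF integrable_integral[OF ik'] bounded_linear_Re])
      have "(Re \<circ> ?k) t \<le> 0" if t: "t \<in> {\<epsilon>..\<delta>}" for t
      proof -
        have t0: "t > 0" "t \<le> 1" using t \<epsilon> \<delta> by auto
        have "Re (?k t) = (cos (l * f 0 t) - 1) / t"
          using \<phi>[of t] t0 by (simp add: osc_kernel_def Re_exp diff_divide_distrib)
        then show ?thesis unfolding o_apply using t0 by (simp only:) (simp add: divide_le_0_iff)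
      qed
      then have "0 \<le> - Re (integral {\<epsilon>..\<delta>} ?k)"
        by (intro has_integral_nonneg[OF has_integral_neg[OF int]]) (simp only: neg_0_le_iff_le)
      then show ?thesis by simp
    qed
    moreover have "Re (integral {\<delta>..1} (osc_kernel (f 0) l)) \<le> 2 / q"
      using osc complex_Re_le_cmod order_trans by blast
    moreover have "- Re (integral {\<epsilon>..1} ?k) \<le> norm (integral {\<epsilon>..1} ?k)"
      using abs_Re_le_cmod[of "integral {\<epsilon>..1} ?k"] by linarith
    ultimately show ?thesis by linarith
  qed
  have "((\<lambda>\<epsilon>. norm (integral {\<epsilon>..1} ?k)) \<longlongrightarrow> norm (pv_osc (f 0) l)) (at_right 0)"
    by (intro tendsto_norm tendsto_pv_osc[OF derivative_chainD[OF f]])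
  moreover have "\<forall>\<^sub>F \<epsilon> in at_right 0. - ln \<delta> - 2 / q \<le> norm (integral {\<epsilon>..1} ?k)"
    unfolding eventually_at_right[OF \<delta>(1)] using bound \<delta>(1) by (auto intro!: exI[of _ \<delta>])
  ultimately show ?thesis by (rule tendsto_lowerbound) simp
qed

section \<open>A convex flat function with Gevrey bounds\<close>

text \<open>
  The functions \<open>exp (- 1 / x) / (x ^ j j!)\<close>, extended by 0. With this normalisation they are bounded
  by 1, and differentiation acts on them by a recursion with coefficients polynomial in \<open>j\<close>, from which the
  bounds on all derivatives can be read off by induction.
\<close>
definition flat_exp :: "nat \<Rightarrow> real \<Rightarrow> real" where
  "flat_exp j x = (if x \<le> 0 then 0 else exp (- 1 / x) / (x ^ j * fact j))"

primrec flat_exp_deriv :: "nat \<Rightarrow> nat \<Rightarrow> real \<Rightarrow> real" where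
  "flat_exp_deriv 0 j = flat_exp j"
| "flat_exp_deriv (Suc n) j = (\<lambda>x. real ((j + 1) * (j + 2)) * flat_exp_deriv n (j + 2) x
     - real (j * (j + 1)) * flat_exp_deriv n (j + 1) x)"

lemma flat_exp_nonneg: "0 \<le> flat_exp j x"
  by (simp add: flat_exp_def)

lemma flat_exp_le_1: "flat_exp j x \<le> 1"
proof (cases "x \<le> 0")
  case False
  have "(\<Sum>i\<in>{j}. (1 / x) ^ i /\<^sub>R fact i) \<le> (\<Sum>i. (1 / x) ^ i /\<^sub>R fact i)"
    using False by (intro sum_le_suminf summable_exp_generic) auto
  then have "(1 / x) ^ j / fact j \<le> exp (1 / x)"
    by (simp add: exp_def field_simps)
  then have "exp (- (1 / x)) * ((1 / x) ^ j / fact j) \<le> exp (- (1 / x)) * exp (1 / x)"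
    by (intro mult_left_mono) auto
  then show ?thesis using False by (simp add: flat_exp_def power_inverse divide_inverse mult_ac flip: exp_add)
qed (simp add: flat_exp_def)

lemma flat_exp_shift: "x * (real (Suc j) * flat_exp (Suc j) x) = flat_exp j x"
  by (simp add: flat_exp_def field_simps del: of_nat_Suc)

text \<open>
  At the origin the derivative is 0 because \<open>flat_exp j\<close> is \<open>x^2\<close> times a bounded function.
\<close>
lemma DERIV_flat_exp: "(flat_exp j has_real_derivative flat_exp_deriv 1 j x) (at x)"
proof (cases x "0 :: real" rule: linorder_cases)
  case less
  have "(flat_exp j has_real_derivative 0) (at x) \<longleftrightarrow> ((\<lambda>_. 0 :: real) has_real_derivative 0) (at x)"
    using eventually_nhds_in_open[of "{..<0}" x] less
    by (intro DERIV_cong_ev) (auto simp: flat_exp_def elim!: eventually_mono)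
  then show ?thesis using less by (simp add: flat_exp_def)
next
  case greater
  have "(flat_exp j has_real_derivative flat_exp_deriv 1 j x) (at x) \<longleftrightarrow>
      ((\<lambda>x. exp (- 1 / x) / (x ^ j * fact j)) has_real_derivative flat_exp_deriv 1 j x) (at x)"
    using eventually_nhds_in_open[of "{0<..}" x] greater
    by (intro DERIV_cong_ev) (auto simp: flat_exp_def elim!: eventually_mono)
  moreover have "((\<lambda>x. exp (- 1 / x) / (x ^ j * fact j)) has_real_derivative
      (exp (- 1 / x) * (1 / x\<^sup>2) * (x ^ j * fact j) - exp (- 1 / x) * (real j * x ^ (j - 1) * fact j))
        / (x ^ j * fact j)\<^sup>2) (at x)"
    using greater by (auto intro!: derivative_eq_intros simp: power2_eq_square)
  moreover have "(exp (- 1 / x) * (1 / x\<^sup>2) * (x ^ j * fact j) - exp (- 1 / x) * (real j * x ^ (j - 1) * fact j))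
        / (x ^ j * fact j)\<^sup>2 = flat_exp_deriv 1 j x"
  proof -
    have f: "fact (j + 2) = real ((j + 1) * (j + 2)) * fact j" "fact (j + 1) = real (j + 1) * fact j"
      by (simp_all add: algebra_simps)
    have "flat_exp_deriv 1 j x = exp (- 1 / x) / (x ^ (j + 2) * fact j) - real j * exp (- 1 / x) / (x ^ (j + 1) * fact j)"
    proof -
      have cancel: "J * R * (e / (P * (R * F))) = J * e / (P * F)" if "R \<noteq> 0" for J R e P F :: real
        using that by simp
      have "real ((j + 1) * (j + 2)) * flat_exp (j + 2) x
          = 1 * real ((j + 1) * (j + 2)) * (exp (- 1 / x) / (x ^ (j + 2) * (real ((j + 1) * (j + 2)) * fact j)))"
        using greater by (simp only: flat_exp_def f not_le[symmetric] if_False mult_1)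
      also have "\<dots> = 1 * exp (- 1 / x) / (x ^ (j + 2) * fact j)"
        by (rule cancel) (simp only: of_nat_eq_0_iff mult_is_0, simp)
      finally have 1: "real ((j + 1) * (j + 2)) * flat_exp (j + 2) x = exp (- 1 / x) / (x ^ (j + 2) * fact j)"
        by simp
      have "real (j * (j + 1)) * flat_exp (j + 1) x
          = real j * real (j + 1) * (exp (- 1 / x) / (x ^ (j + 1) * (real (j + 1) * fact j)))"
        using greater by (simp only: flat_exp_def f not_le[symmetric] if_False of_nat_mult)
      also have "\<dots> = real j * exp (- 1 / x) / (x ^ (j + 1) * fact j)" by (rule cancel) simp
      finally show ?thesis using 1 by (simp only: One_nat_def flat_exp_deriv.simps)
    qed
    also have "\<dots> = (exp (- 1 / x) * (1 / x\<^sup>2) * (x ^ j * fact j) - exp (- 1 / x) * (real j * x ^ (j - 1) * fact j))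
        / (x ^ j * fact j)\<^sup>2"
    proof -
      have alg: "e / (p * x\<^sup>2 * F) - J * e / (p * x * F)
          = (e * (1 / x\<^sup>2) * (p * F) - e * (J * (p / x) * F)) / (p * F)\<^sup>2"
        if "p \<noteq> 0" "F \<noteq> 0" "x \<noteq> 0" for e p F J x :: real
      proof -
        define q where "q = p * F"
        have q: "q \<noteq> 0" using that by (simp add: q_def)
        have "e * (1 / x\<^sup>2) * (p * F) - e * (J * (p / x) * F) = (e / x\<^sup>2 - J * e / x) * q"
          by (simp add: q_def left_diff_distrib)
        moreover have "e / (p * x\<^sup>2 * F) - J * e / (p * x * F) = (e / x\<^sup>2 - J * e / x) / q"
          by (simp add: q_def diff_divide_distrib mult_ac)
        ultimately show ?thesis using q by (simp add: power2_eq_square q_def)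
      qed
      have pow: "real j * x ^ (j - 1) = real j * (x ^ j / x)" using greater by (cases j) auto
      show ?thesis
        unfolding pow power_add power_one_right by (rule alg) (use greater in auto)
    qed
    finally show ?thesis by simp
  qed
  ultimately show ?thesis by simp
next
  case equal
  let ?C = "real ((j + 1) * (j + 2))"
  have bound: "\<bar>flat_exp j h\<bar> \<le> ?C * h\<^sup>2" for h
  proof -
    have "flat_exp j h = h * (real (Suc j) * (h * (real (Suc (Suc j)) * flat_exp (Suc (Suc j)) h)))"
      by (simp only: flat_exp_shift)
    also have "\<dots> = ?C * h\<^sup>2 * flat_exp (j + 2) h" by (simp add: power2_eq_square algebra_simps)
    finally have "\<bar>flat_exp j h\<bar> = ?C * h\<^sup>2 * flat_exp (j + 2) h"
      using flat_exp_nonneg[of j h] by simp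
    also have "\<dots> \<le> ?C * h\<^sup>2 * 1"
      by (intro mult_left_mono flat_exp_le_1) auto
    finally show ?thesis by simp
  qed
  have "((\<lambda>h. (flat_exp j (0 + h) - flat_exp j 0) / h) \<longlongrightarrow> 0) (at 0)"
  proof (rule tendsto_0_le[where K = 1])
    show "((\<lambda>h. ?C * h) \<longlongrightarrow> 0) (at 0)"
      by (rule tendsto_eq_intros refl)+ simp
    show "\<forall>\<^sub>F h in at 0. norm ((flat_exp j (0 + h) - flat_exp j 0) / h) \<le> norm (?C * h) * 1"
    proof (rule eventually_mono[OF eventually_neq_at_within[of 0]])
      fix h :: real assume "h \<noteq> 0"
      have cancel: "c * (a * a) / a = c * a" if "a \<noteq> 0" for a c :: real using that by simp
      have "\<bar>flat_exp j h\<bar> / \<bar>h\<bar> \<le> ?C * h\<^sup>2 / \<bar>h\<bar>"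
        using bound[of h] by (intro divide_right_mono) auto
      also have "h\<^sup>2 = \<bar>h\<bar> * \<bar>h\<bar>" by (simp add: power2_eq_square)
      also have "?C * (\<bar>h\<bar> * \<bar>h\<bar>) / \<bar>h\<bar> = ?C * \<bar>h\<bar>"
        by (rule cancel) (use \<open>h \<noteq> 0\<close> in simp)
      finally show "norm ((flat_exp j (0 + h) - flat_exp j 0) / h) \<le> norm (?C * h) * 1"
        by (simp add: flat_exp_def abs_mult del: of_nat_mult of_nat_add)
    qed
  qed
  then show ?thesis using equal by (simp add: DERIV_def flat_exp_def)
qed

lemma DERIV_flat_exp_deriv:
  "(flat_exp_deriv n j has_real_derivative flat_exp_deriv (Suc n) j x) (at x)"
proof (induction n arbitrary: j)
  case 0
  then show ?case using DERIV_flat_exp by simp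
next
  case (Suc n)
  from DERIV_diff[OF DERIV_cmult[OF Suc[of "j + 2"], of "real ((j + 1) * (j + 2))"]
      DERIV_cmult[OF Suc[of "j + 1"], of "real (j * (j + 1))"]]
  show ?case by (simp only: flat_exp_deriv.simps(2))
qed

lemma flat_exp_deriv_bound: "\<bar>flat_exp_deriv n j x\<bar> \<le> 2 ^ n * fact (j + 2 * n) / fact j"
proof (induction n arbitrary: j)
  case 0
  then show ?case using flat_exp_nonneg[of j x] flat_exp_le_1[of j x] by simp
next
  case (Suc n)
  let ?F = "fact (j + 2 * Suc n) / fact j :: real"
  have "\<bar>flat_exp_deriv (Suc n) j x\<bar> \<le> real ((j + 1) * (j + 2)) * \<bar>flat_exp_deriv n (j + 2) x\<bar>
     + real (j * (j + 1)) * \<bar>flat_exp_deriv n (j + 1) x\<bar>"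
    using abs_triangle_ineq4[of "real ((j + 1) * (j + 2)) * flat_exp_deriv n (j + 2) x"
        "real (j * (j + 1)) * flat_exp_deriv n (j + 1) x"]
    by (simp add: abs_mult)
  also have "\<dots> \<le> 2 ^ n * ?F + 2 ^ n * ?F"
  proof (rule add_mono)
    have f: "fact (j + 2) = real ((j + 1) * (j + 2)) * fact j" by (simp add: algebra_simps)
    have "real ((j + 1) * (j + 2)) * \<bar>flat_exp_deriv n (j + 2) x\<bar>
        \<le> real ((j + 1) * (j + 2)) * (2 ^ n * fact (j + 2 + 2 * n) / fact (j + 2))"
      by (intro mult_left_mono Suc) auto
    also have "\<dots> = 2 ^ n * ?F" unfolding f by (simp del: of_nat_mult of_nat_add fact_Suc add: add_ac)
    finally show "real ((j + 1) * (j + 2)) * \<bar>flat_exp_deriv n (j + 2) x\<bar> \<le> 2 ^ n * ?F" .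
  next
    have f: "fact (j + 1) = real (j + 1) * fact j" by simp
    have g: "fact (j + 2 * Suc n) = real (j + 2 * Suc n) * fact (j + 1 + 2 * n)"
      by (simp add: algebra_simps)
    have "real (j * (j + 1)) * \<bar>flat_exp_deriv n (j + 1) x\<bar>
        \<le> real (j * (j + 1)) * (2 ^ n * fact (j + 1 + 2 * n) / fact (j + 1))"
      by (intro mult_left_mono Suc) auto
    also have "\<dots> = 2 ^ n * (real j * fact (j + 1 + 2 * n) / fact j)"
      unfolding f of_nat_mult by (simp del: of_nat_add fact_Suc)
    also have "\<dots> \<le> 2 ^ n * ?F"
      unfolding g by (intro mult_left_mono divide_right_mono mult_right_mono) auto
    finally show "real (j * (j + 1)) * \<bar>flat_exp_deriv n (j + 1) x\<bar> \<le> 2 ^ n * ?F" .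
  qed
  also have "\<dots> = 2 ^ Suc n * ?F" by (simp only: power_Suc mult_2 ring_distribs)
  finally show ?case by (simp only: times_divide_eq_right)
qed

text \<open>
  The successive derivatives of \<open>x exp (- 1 / x)\<close>, extended by 0 to \<open>x \<le> 0\<close>: a convex function with
  Gevrey bounds, flat at 0 and with derivative tending to 1 at infinity. Convexity is why it is
  preferred to \<open>exp (- 1 / x)\<close>.
\<close>
primrec ramp :: "nat \<Rightarrow> real \<Rightarrow> real" where
  "ramp 0 = (\<lambda>x. x * flat_exp 0 x)"
| "ramp (Suc n) = (\<lambda>x. flat_exp_deriv n 0 x + flat_exp_deriv n 1 x)"

lemma DERIV_ramp: "(ramp n has_real_derivative ramp (Suc n) x) (at x)"
proof (cases n)
  case 0
  have "((\<lambda>x. x * flat_exp 0 x) has_real_derivative x * flat_exp_deriv 1 0 x + 1 * flat_exp 0 x) (at x)"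
    by (intro DERIV_mult' DERIV_ident DERIV_flat_exp)
  moreover have "x * flat_exp_deriv 1 0 x = flat_exp 1 x"
    using flat_exp_shift[of x 1] by (simp add: numeral_2_eq_2)
  ultimately show ?thesis using 0 by (simp add: add.commute)
next
  case (Suc k)
  show ?thesis unfolding Suc ramp.simps
    by (intro DERIV_add DERIV_flat_exp_deriv)
qed

lemma ramp_eq_0: "x \<le> 0 \<Longrightarrow> ramp 0 x = 0"
  by (simp add: flat_exp_def)

lemma ramp_1_nonneg: "0 \<le> ramp 1 x"
  by (simp add: flat_exp_nonneg)

lemma ramp_1_at_1: "ramp 1 1 = 2 * exp (- 1)"
  by (simp add: flat_exp_def)

lemma ramp_2_nonneg: "0 \<le> ramp 2 x"
proof -
  have "ramp 2 x = 6 * flat_exp 3 x" by (simp add: numeral_2_eq_2 numeral_3_eq_3)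
  then show ?thesis by (simp add: flat_exp_nonneg)
qed

lemma ramp_bound:
  assumes "\<bar>x\<bar> \<le> R" "R \<ge> 1"
  shows "\<bar>ramp n x\<bar> \<le> R * (2 ^ n * fact (2 * n))"
proof (cases n)
  case 0
  have "\<bar>x\<bar> * \<bar>flat_exp 0 x\<bar> \<le> R * 1"
    using assms flat_exp_nonneg[of 0 x] flat_exp_le_1[of 0 x] by (intro mult_mono) auto
  then show ?thesis using 0 by (simp add: abs_mult)
next
  case (Suc k)
  have "\<bar>ramp n x\<bar> \<le> \<bar>flat_exp_deriv k 0 x\<bar> + \<bar>flat_exp_deriv k 1 x\<bar>"
    using Suc by (simp add: abs_triangle_ineq)
  also have "\<dots> \<le> 2 ^ k * fact (2 * n) + 2 ^ k * fact (2 * n)"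
  proof (rule add_mono)
    have "\<bar>flat_exp_deriv k 0 x\<bar> \<le> 2 ^ k * fact (2 * k)" using flat_exp_deriv_bound[of k 0 x] by simp
    also have "\<dots> \<le> 2 ^ k * fact (2 * n)" using Suc by (intro mult_left_mono fact_mono) auto
    finally show "\<bar>flat_exp_deriv k 0 x\<bar> \<le> 2 ^ k * fact (2 * n)" .
    have "\<bar>flat_exp_deriv k 1 x\<bar> \<le> 2 ^ k * fact (1 + 2 * k)" using flat_exp_deriv_bound[of k 1 x] by simp
    also have "\<dots> \<le> 2 ^ k * fact (2 * n)" using Suc by (intro mult_left_mono fact_mono) auto
    finally show "\<bar>flat_exp_deriv k 1 x\<bar> \<le> 2 ^ k * fact (2 * n)" .
  qed
  also have "\<dots> = 1 * (2 ^ n * fact (2 * n))" using Suc by simp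
  also have "\<dots> \<le> R * (2 ^ n * fact (2 * n))" using assms by (intro mult_right_mono) auto
  finally show ?thesis .
qed

section \<open>A lacunary series in the class\<close>

lemma ln_le_powr:
  fixes \<delta> \<epsilon> :: real
  assumes "\<delta> > 0" "\<epsilon> > 0"
  shows "\<exists>C\<ge>0. \<forall>x\<ge>1. ln x \<le> \<epsilon> * x powr \<delta> + C"
proof (intro exI conjI allI impI)
  fix x :: real assume x: "x \<ge> 1"
  have pos: "0 < x powr \<delta>" "0 < \<delta> * \<epsilon>" using x assms by auto
  have "ln (\<delta> * \<epsilon>) + \<delta> * ln x = ln (\<delta> * \<epsilon> * x powr \<delta>)"
    using pos x assms by (simp add: ln_mult ln_powr)
  also have "\<dots> \<le> \<delta> * \<epsilon> * x powr \<delta> - 1" using pos by (intro ln_le_minus_one) simp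
  finally have "\<delta> * ln x \<le> \<delta> * (\<epsilon> * x powr \<delta>) + \<bar>ln (\<delta> * \<epsilon>)\<bar>" by simp
  also have "\<dots> = \<delta> * (\<epsilon> * x powr \<delta> + \<bar>ln (\<delta> * \<epsilon>)\<bar> / \<delta>)" using assms by (simp add: algebra_simps)
  finally show "ln x \<le> \<epsilon> * x powr \<delta> + \<bar>ln (\<delta> * \<epsilon>)\<bar> / \<delta>" using assms by simp
qed (use assms in simp)

text \<open>
  A form of Young's inequality for the conjugate exponents \<open>\<alpha> / (\<alpha> - 1)\<close> and \<open>\<alpha>\<close>, proved by
  comparing the two terms; the constants are not optimal, but the second one tends to 0 as \<open>B\<close> grows.
\<close>
lemma mult_le_powr_conjugate:
  fixes x y B \<alpha> :: real
  assumes "x \<ge> 0" "y \<ge> 0" "B > 0" "\<alpha> > 1"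
  shows "x * y \<le> B * x powr (\<alpha> / (\<alpha> - 1)) + (1 / B) powr (\<alpha> - 1) * y powr \<alpha>"
proof (cases "x = 0 \<or> y \<le> B * x powr (1 / (\<alpha> - 1))")
  case True
  have "x * y \<le> B * x powr (\<alpha> / (\<alpha> - 1))"
  proof (cases "x = 0")
    case False
    then have "x * y \<le> x * (B * x powr (1 / (\<alpha> - 1)))"
      using True assms by (intro mult_left_mono) auto
    also have "\<dots> = B * x powr (1 + 1 / (\<alpha> - 1))" using False assms by (simp add: powr_add)
    also have "1 + 1 / (\<alpha> - 1) = \<alpha> / (\<alpha> - 1)" using assms by (simp add: field_simps)
    finally show ?thesis .
  qed simp
  then show ?thesis by (simp add: add_increasing2)
next
  case False
  then have x: "x > 0" and "B * x powr (1 / (\<alpha> - 1)) < y" using assms by auto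
  then have "x powr (1 / (\<alpha> - 1)) \<le> y / B" and y: "y > 0"
    using assms by (auto simp: field_simps intro: le_less_trans[rotated])
  then have "(x powr (1 / (\<alpha> - 1))) powr (\<alpha> - 1) \<le> (y / B) powr (\<alpha> - 1)"
    using assms by (intro powr_mono2) auto
  then have "x \<le> (y / B) powr (\<alpha> - 1)" using x assms by (simp add: powr_powr)
  then have "x * y \<le> (y / B) powr (\<alpha> - 1) * y" using y by (intro mult_right_mono) auto
  also have "\<dots> = (1 / B) powr (\<alpha> - 1) * (y powr (\<alpha> - 1) * y)"
    using assms by (simp add: powr_divide)
  also have "y powr (\<alpha> - 1) * y = y powr \<alpha>" using y by (simp add: powr_diff)
  finally show ?thesis using assms by (simp add: add_increasing)
qed

text \<open>
  The \<open>n\<close>-th derivatives of the lacunary sum of the dilates \<open>ramp 0 (2 ^ k t)\<close> with weights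
  \<open>exp (- A k powr \<gamma>)\<close>. The logarithm of the sum at
  \<open>t = 2 powr (- k)\<close> is \<open>- A k powr \<gamma>\<close> to leading order. For \<open>\<gamma> = \<alpha> / (\<alpha> - 1)\<close> this is, up to the value
  of \<open>A\<close>, the slowest decay at 0 that the class allows a flat function.
\<close>
definition ramp_series :: "real \<Rightarrow> real \<Rightarrow> nat \<Rightarrow> real \<Rightarrow> real" where
  "ramp_series A \<gamma> n t = (\<Sum>k. exp (- A * real k powr \<gamma>) * ((2 ^ k) ^ n * ramp n (2 ^ k * t)))"

text \<open>
  The dilation costs \<open>2 ^ (k n)\<close> by the chain rule and \<open>2 ^ k\<close> by the linear growth of \<open>ramp 0\<close>; by
  the inequality above both together are absorbed by half of the weight and a factor \<open>exp (\<eta> (n + 1) powr \<alpha>)\<close> with \<open>\<eta> = (2 / A) powr (\<alpha> - 1)\<close>; this is where the duality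
  of \<open>\<alpha>\<close> and \<open>\<alpha> / (\<alpha> - 1)\<close> enters. The other half of the weight decays at least geometrically
  in \<open>k\<close>.
\<close>
lemma ramp_series_term_bound:
  assumes A: "A > 0" and \<alpha>: "\<alpha> > 1" and t: "t \<in> {-1..1}"
  shows "\<bar>exp (- A * real k powr (\<alpha> / (\<alpha> - 1))) * ((2 ^ k) ^ n * ramp n (2 ^ k * t))\<bar>
    \<le> exp (- A / 2) ^ k * (exp ((2 / A) powr (\<alpha> - 1) * (real n + 1) powr \<alpha>) * (2 ^ n * fact (2 * n)))"
proof -
  define \<gamma> where "\<gamma> = \<alpha> / (\<alpha> - 1)"
  define Y where "Y = (2 / A) powr (\<alpha> - 1) * (real n + 1) powr \<alpha>"
  have "\<gamma> \<ge> 1" using \<alpha> by (simp add: \<gamma>_def)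
  then have k\<gamma>: "real k \<le> real k powr \<gamma>"
    using powr_mono[of 1 \<gamma> "real k"] by (cases "k = 0") auto
  have "\<bar>2 ^ k * t\<bar> \<le> 2 ^ k" using t by (simp add: abs_mult abs_le_iff mult_left_le)
  then have "\<bar>ramp n (2 ^ k * t)\<bar> \<le> 2 ^ k * (2 ^ n * fact (2 * n))"
    by (rule ramp_bound) simp
  then have "\<bar>exp (- A * real k powr \<gamma>) * ((2 ^ k) ^ n * ramp n (2 ^ k * t))\<bar>
      \<le> exp (- A * real k powr \<gamma>) * ((2 ^ k) ^ n * (2 ^ k * (2 ^ n * fact (2 * n))))"
    unfolding abs_mult by (intro mult_mono) auto
  also have "\<dots> = (exp (- A * real k powr \<gamma>) * 2 ^ (k * (n + 1))) * (2 ^ n * fact (2 * n))"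
    by (simp add: power_add power_mult mult_ac)
  also have "\<dots> \<le> (exp (- A / 2) ^ k * exp Y) * (2 ^ n * fact (2 * n))"
  proof (rule mult_right_mono)
    have "(2 :: real) ^ (k * (n + 1)) \<le> exp 1 ^ (k * (n + 1))"
      using exp_ge_add_one_self[of "1 :: real"] by (intro power_mono) auto
    also have "\<dots> = exp (real k * (real n + 1))"
      by (simp add: algebra_simps flip: exp_of_nat_mult)
    also have "\<dots> \<le> exp (A / 2 * real k powr \<gamma> + Y)"
      using mult_le_powr_conjugate[of "real k" "real n + 1" "A / 2" \<alpha>] A \<alpha>
      by (simp add: \<gamma>_def Y_def)
    finally have "exp (- A * real k powr \<gamma>) * 2 ^ (k * (n + 1))
        \<le> exp (- A * real k powr \<gamma>) * exp (A / 2 * real k powr \<gamma> + Y)"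
      by (intro mult_left_mono) auto
    also have "\<dots> = exp (- (A / 2 * real k powr \<gamma>)) * exp Y"
      by (simp flip: exp_add)
    also have "\<dots> \<le> exp (- (A / 2 * real k)) * exp Y"
      using A k\<gamma> by (intro mult_right_mono) auto
    also have "exp (- (A / 2 * real k)) = exp (- A / 2) ^ k"
      by (simp add: mult.commute flip: exp_of_nat_mult)
    finally show "exp (- A * real k powr \<gamma>) * 2 ^ (k * (n + 1)) \<le> exp (- A / 2) ^ k * exp Y" .
  qed auto
  finally show ?thesis by (simp only: \<gamma>_def Y_def mult.assoc)
qed

context
  fixes A \<alpha> \<gamma> :: real
  assumes A: "A > 0" and \<alpha>: "\<alpha> > 1" and \<gamma>: "\<gamma> = \<alpha> / (\<alpha> - 1)"
begin

lemma norm_ramp_series_term: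
  assumes "t \<in> {-1..1}"
  shows "norm (exp (- A * real k powr \<gamma>) * ((2 ^ k) ^ n * ramp n (2 ^ k * t)))
    \<le> exp (- A / 2) ^ k * (exp ((2 / A) powr (\<alpha> - 1) * (real n + 1) powr \<alpha>) * (2 ^ n * fact (2 * n)))"
  unfolding real_norm_def \<gamma> by (rule ramp_series_term_bound[OF A \<alpha> assms])

lemma summable_ramp_majorant: "summable (\<lambda>k. exp (- A / 2) ^ k * (C :: real))"
  using A by (intro summable_mult2 summable_geometric) simp

lemma summable_ramp_series:
  assumes "t \<in> {-1..1}"
  shows "summable (\<lambda>k. exp (- A * real k powr \<gamma>) * ((2 ^ k) ^ n * ramp n (2 ^ k * t)))"
  by (rule summable_comparison_test'[OF summable_ramp_majorant, where N = 0])
     (rule norm_ramp_series_term[OF assms])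

lemma ramp_series_bound:
  assumes "t \<in> {-1..1}"
  shows "\<bar>ramp_series A \<gamma> n t\<bar> \<le> 1 / (1 - exp (- A / 2))
     * (exp ((2 / A) powr (\<alpha> - 1) * (real n + 1) powr \<alpha>) * (2 ^ n * fact (2 * n)))"
proof -
  have "norm (ramp_series A \<gamma> n t) \<le> (\<Sum>k. exp (- A / 2) ^ k
      * (exp ((2 / A) powr (\<alpha> - 1) * (real n + 1) powr \<alpha>) * (2 ^ n * fact (2 * n))))"
    unfolding ramp_series_def
    by (rule norm_suminf_le[OF norm_ramp_series_term[OF assms] summable_ramp_majorant])
  also have "\<dots> = (\<Sum>k. exp (- A / 2) ^ k)
      * (exp ((2 / A) powr (\<alpha> - 1) * (real n + 1) powr \<alpha>) * (2 ^ n * fact (2 * n)))"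
    using A by (intro suminf_mult2[symmetric] summable_geometric) simp
  finally show ?thesis using A by (simp add: suminf_geometric)
qed

lemma derivative_chain_ramp_series: "derivative_chain {-1..1} (ramp_series A \<gamma>)"
  unfolding derivative_chain_def
proof (intro allI ballI)
  fix n and t :: real assume t: "t \<in> {-1..1}"
  let ?f = "\<lambda>n k t. exp (- A * real k powr \<gamma>) * ((2 ^ k) ^ n * ramp n (2 ^ k * t))"
  have "\<exists>g. \<forall>x\<in>{-1..1}. (\<lambda>k. ?f n k x) sums g x \<and>
      (g has_real_derivative ramp_series A \<gamma> (Suc n) x) (at x within {-1..1})"
  proof (rule has_field_derivative_series)
    fix k and x :: real
    have "((\<lambda>t. ramp n (2 ^ k * t)) has_real_derivative ramp (Suc n) (2 ^ k * x) * 2 ^ k) (at x within {-1..1})"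
      by (rule DERIV_chain2[OF DERIV_ramp]) (auto intro!: derivative_eq_intros)
    from DERIV_cmult[OF DERIV_cmult[OF this, of "(2 ^ k) ^ n"], of "exp (- A * real k powr \<gamma>)"]
    show "(?f n k has_real_derivative ?f (Suc n) k x) (at x within {-1..1})"
      by (simp add: mult_ac)
  next
    show "uniform_limit {-1..1} (\<lambda>m x. \<Sum>k<m. ?f (Suc n) k x) (ramp_series A \<gamma> (Suc n)) sequentially"
      unfolding ramp_series_def[abs_def]
      by (rule Weierstrass_m_test[OF norm_ramp_series_term summable_ramp_majorant])
    show "summable (\<lambda>k. ?f n k 0)" by (rule summable_ramp_series) simp
  qed auto
  then obtain g where g: "\<And>x. x \<in> {-1..1} \<Longrightarrow> (\<lambda>k. ?f n k x) sums g x"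
      "\<And>x. x \<in> {-1..1} \<Longrightarrow> (g has_real_derivative ramp_series A \<gamma> (Suc n) x) (at x within {-1..1})"
    by blast
  show "(ramp_series A \<gamma> n has_real_derivative ramp_series A \<gamma> (Suc n) t) (at t within {-1..1})"
    by (rule has_field_derivative_transform_within[OF g(2)[OF t] zero_less_one t])
       (use g(1) in \<open>simp add: ramp_series_def sums_iff\<close>)
qed

lemma ramp_series_left: "t \<le> 0 \<Longrightarrow> ramp_series A \<gamma> 0 t = 0"
  unfolding ramp_series_def by (simp add: ramp_eq_0 mult_nonneg_nonpos del: ramp.simps)

lemma ramp_series_2_nonneg:
  assumes "t \<in> {-1..1}"
  shows "0 \<le> ramp_series A \<gamma> 2 t"
  unfolding ramp_series_def
  by (intro suminf_nonneg summable_ramp_series assms mult_nonneg_nonneg ramp_2_nonneg) auto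

lemma ramp_series_1_ge: "2 * exp (- 1) * exp (- A * real k powr \<gamma>) \<le> 1 / 2 ^ k * ramp_series A \<gamma> 1 (1 / 2 ^ k)"
proof -
  let ?t = "1 / 2 ^ k :: real"
  have t: "?t \<in> {-1..1}" by (auto simp: order_trans[of "- 1" 0])
  let ?f = "\<lambda>i. exp (- A * real i powr \<gamma>) * ((2 ^ i) ^ 1 * ramp 1 (2 ^ i * ?t))"
  have "sum ?f {k} \<le> suminf ?f"
    by (rule sum_le_suminf[OF summable_ramp_series[OF t]])
       (auto simp del: ramp.simps One_nat_def intro!: mult_nonneg_nonneg ramp_1_nonneg)
  then have "exp (- A * real k powr \<gamma>) * (2 ^ k * (2 * exp (- 1))) \<le> ramp_series A \<gamma> 1 ?t"
    by (simp add: ramp_series_def ramp_1_at_1 del: ramp.simps One_nat_def)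
  then have "?t * (exp (- A * real k powr \<gamma>) * (2 ^ k * (2 * exp (- 1)))) \<le> ?t * ramp_series A \<gamma> 1 ?t"
    by (intro mult_left_mono) auto
  then show ?thesis by (simp add: mult_ac)
qed

end

text \<open>
  Since \<open>\<alpha> > 1\<close>, the weight \<open>exp (c n powr \<alpha>)\<close> dominates every power of \<open>n!\<close> up to a geometric
  factor, however small \<open>c\<close> is; so Gevrey bounds are harmless.
\<close>
lemma power_mult_fact_le_exp_powr:
  assumes \<alpha>: "\<alpha> > 1" and c: "c > 0"
  shows "\<exists>K\<ge>1. \<forall>n. 2 ^ n * fact (2 * n) \<le> K ^ n * exp (c * real n powr \<alpha>)"
proof -
  obtain C where C: "C \<ge> 0" "\<And>x. x \<ge> 1 \<Longrightarrow> ln x \<le> c / 2 * x powr (\<alpha> - 1) + C"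
    using ln_le_powr[of "\<alpha> - 1" "c / 2"] \<alpha> c by auto
  define K where "K = 2 * exp (2 * (1 + C))"
  have "1 \<le> exp (2 * (1 + C))" using C by simp
  then have K: "K \<ge> 1" unfolding K_def by linarith
  have "2 ^ n * fact (2 * n) \<le> K ^ n * exp (c * real n powr \<alpha>)" for n
  proof (cases "n = 0")
    case False
    then have n: "real n \<ge> 1" by simp
    have "ln (real (2 * n)) = ln 2 + ln n" using n by (simp add: ln_mult)
    also have "\<dots> \<le> 1 + (c / 2 * real n powr (\<alpha> - 1) + C)"
      using C(2)[OF n] ln_le_minus_one[of "2 :: real"] by simp
    finally have "real (2 * n) * ln (real (2 * n)) \<le> real (2 * n) * (1 + (c / 2 * real n powr (\<alpha> - 1) + C))"
      by (intro mult_left_mono) auto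
    also have "\<dots> = real n * (2 * (1 + C)) + c * (real n powr (\<alpha> - 1) * real n)"
      by (simp add: algebra_simps)
    also have "real n powr (\<alpha> - 1) * real n = real n powr \<alpha>"
      using n by (simp add: powr_diff)
    finally have le: "real (2 * n) * ln (real (2 * n)) \<le> real n * (2 * (1 + C)) + c * real n powr \<alpha>" .
    have "fact (2 * n) \<le> real ((2 * n) ^ (2 * n))" by (rule fact_le_power)
    also have "\<dots> = real (2 * n) powr real (2 * n)" using n by (subst powr_realpow) auto
    also have "\<dots> = exp (real (2 * n) * ln (real (2 * n)))" using n by (simp add: powr_def)
    also have "\<dots> \<le> exp (real n * (2 * (1 + C)) + c * real n powr \<alpha>)" using le by simp
    also have "\<dots> = exp (2 * (1 + C)) ^ n * exp (c * real n powr \<alpha>)"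
      by (simp add: exp_add exp_of_nat_mult)
    finally have "2 ^ n * fact (2 * n) \<le> 2 ^ n * (exp (2 * (1 + C)) ^ n * exp (c * real n powr \<alpha>))"
      by (intro mult_left_mono) auto
    then show ?thesis by (simp add: K_def power_mult_distrib mult_ac)
  qed simp
  then show ?thesis using K by blast
qed

text \<open>
  The class fixes \<open>c\<close> and leaves only a geometric factor free, so the growth of the derivatives in the
  exponent must be made small: a large \<open>A\<close> makes \<open>\<eta> = (2 / A) powr (\<alpha> - 1)\<close> small, and half of
  \<open>c\<close> is spent on the dilations, the other half on the factorials.
\<close>
lemma ramp_series_in_carleman_class:
  assumes \<alpha>: "\<alpha> > 1" and c: "c > 0" and M: "\<And>n. M n = exp (c * real n powr \<alpha>)"
  shows "\<exists>A>0. ramp_series A (\<alpha> / (\<alpha> - 1)) 0 \<in> carleman_class M {-1..1}"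
proof -
  \<comment> \<open>The factor \<open>2 powr \<alpha>\<close> makes up for the step from \<open>n + 1\<close> to \<open>n\<close>.\<close>
  define \<eta> where "\<eta> = c / 2 / 2 powr \<alpha>"
  define A where "A = 2 / \<eta> powr (1 / (\<alpha> - 1))"
  have \<eta>: "\<eta> > 0" using c by (simp add: \<eta>_def)
  have A: "A > 0" using \<eta> by (simp add: A_def)
  have A\<eta>: "(2 / A) powr (\<alpha> - 1) = \<eta>" using \<eta> \<alpha> by (simp add: A_def powr_powr)
  obtain K where K: "K \<ge> 1" "\<And>n. 2 ^ n * fact (2 * n) \<le> K ^ n * exp (c / 2 * real n powr \<alpha>)"
    using power_mult_fact_le_exp_powr[OF \<alpha>, of "c / 2"] c by auto
  define S where "S = 1 / (1 - exp (- A / 2)) * exp \<eta>"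
  have S: "S \<ge> 1"
  proof -
    have "exp (- A / 2) < 1" using A by simp
    then have "1 \<le> 1 / (1 - exp (- A / 2))" by (simp add: field_simps)
    then have "1 * 1 \<le> S" unfolding S_def using \<eta> A by (intro mult_mono) auto
    then show ?thesis by simp
  qed
  have "ramp_series A (\<alpha> / (\<alpha> - 1)) 0 \<in> carleman_class M {-1..1}"
  proof (rule derivative_chain_in_carleman_class[OF derivative_chain_ramp_series[OF A \<alpha> refl]])
    show "0 < S * K" using S K by simp
    fix n and t :: real assume t: "t \<in> {-1..1}"
    have "\<eta> * (real n + 1) powr \<alpha> \<le> \<eta> + c / 2 * real n powr \<alpha>"
    proof (cases "n = 0")
      case False
      then have "(real n + 1) powr \<alpha> \<le> (2 * real n) powr \<alpha>" using \<alpha> by (intro powr_mono2) auto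
      then have "\<eta> * (real n + 1) powr \<alpha> \<le> \<eta> * (2 * real n) powr \<alpha>" using \<eta> by simp
      also have "\<dots> = c / 2 * real n powr \<alpha>" by (simp add: \<eta>_def powr_mult)
      finally show ?thesis using \<eta> by linarith
    qed (use \<eta> in simp)
    then have e: "exp (\<eta> * (real n + 1) powr \<alpha>) \<le> exp \<eta> * exp (c / 2 * real n powr \<alpha>)"
      by (simp flip: exp_add)
    have A1: "0 \<le> 1 / (1 - exp (- A / 2))" using A by simp
    have "\<bar>ramp_series A (\<alpha> / (\<alpha> - 1)) n t\<bar> \<le> 1 / (1 - exp (- A / 2))
        * (exp (\<eta> * (real n + 1) powr \<alpha>) * (2 ^ n * fact (2 * n)))"
      using ramp_series_bound[OF A \<alpha> refl t, of n] unfolding A\<eta> .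
    also have "\<dots> \<le> 1 / (1 - exp (- A / 2))
        * ((exp \<eta> * exp (c / 2 * real n powr \<alpha>)) * (K ^ n * exp (c / 2 * real n powr \<alpha>)))"
      by (intro mult_left_mono mult_mono e K(2) A1) auto
    also have "\<dots> = S * K ^ n * (exp (c / 2 * real n powr \<alpha>) * exp (c / 2 * real n powr \<alpha>))"
      by (simp add: S_def)
    also have "exp (c / 2 * real n powr \<alpha>) * exp (c / 2 * real n powr \<alpha>) = M n"
      by (simp add: M flip: exp_add)
    also have "S * K ^ n * M n \<le> (S * K) ^ (n + 1) * M n"
    proof (rule mult_right_mono)
      have "S ^ 1 \<le> S ^ (n + 1)" "K ^ n \<le> K ^ (n + 1)" using S K(1) self_le_power[of S "n + 1"] by (auto intro!: power_increasing simp del: power_Suc)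
      then have "S ^ 1 * K ^ n \<le> S ^ (n + 1) * K ^ (n + 1)" using S K(1) by (intro mult_mono) auto
      then show "S * K ^ n \<le> (S * K) ^ (n + 1)" by (simp only: power_mult_distrib power_one_right)
    qed (simp add: M)
    finally show "\<bar>ramp_series A (\<alpha> / (\<alpha> - 1)) n t\<bar> \<le> (S * K) ^ (n + 1) * M n" .
  qed
  then show ?thesis using A by blast
qed

section \<open>Sharpness\<close>

text \<open>
  The lower bound at the frequency \<open>l\<close> inverse to the \<open>k\<close>-th weight, with the cut-off \<open>2 ^ (- k)\<close>:
  the \<open>k\<close>-th summand alone makes \<open>l \<delta> f 1 \<delta>\<close> at least \<open>2 / exp 1\<close>.
\<close>
lemma pv_osc_ramp_series_ge:
  assumes A: "A > 0" and \<alpha>: "\<alpha> > 1"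
  shows "real k * ln 2 - exp 1
    \<le> norm (pv_osc (ramp_series A (\<alpha> / (\<alpha> - 1)) 0) (exp (A * real k powr (\<alpha> / (\<alpha> - 1)))))"
proof -
  define \<gamma> where "\<gamma> = \<alpha> / (\<alpha> - 1)"
  let ?l = "exp (A * real k powr \<gamma>)" and ?\<delta> = "1 / 2 ^ k :: real"
  have "- ln ?\<delta> - 2 / (2 * exp (- 1)) \<le> norm (pv_osc (ramp_series A \<gamma> 0) ?l)"
  proof (rule norm_pv_osc_ge[OF derivative_chain_ramp_series[OF A \<alpha> \<gamma>_def]])
    have "?l * (2 * exp (- 1) * exp (- A * real k powr \<gamma>)) \<le> ?l * (?\<delta> * ramp_series A \<gamma> 1 ?\<delta>)"
      by (intro mult_left_mono ramp_series_1_ge[OF A \<alpha> \<gamma>_def]) auto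
    also have "?l * (2 * exp (- 1) * exp (- A * real k powr \<gamma>))
        = 2 * exp (- 1) * (exp (- A * real k powr \<gamma>) * ?l)" by (simp only: mult_ac)
    also have "exp (- A * real k powr \<gamma>) * ?l = 1" by (simp flip: exp_add)
    finally show "2 * exp (- 1) \<le> ?l * (?\<delta> * ramp_series A \<gamma> 1 ?\<delta>)" by simp
  qed (auto intro: ramp_series_left[OF A \<alpha> \<gamma>_def] ramp_series_2_nonneg[OF A \<alpha> \<gamma>_def])
  moreover have "- ln ?\<delta> = real k * ln 2" by (simp add: ln_div ln_realpow)
  moreover have "2 / (2 * exp (- 1)) = exp (1 :: real)" by (simp add: exp_minus inverse_eq_divide)
  ultimately show ?thesis by (simp only: \<gamma>_def)
qed

theorem theorem7p1:
  fixes \<alpha> c :: real and M :: "nat \<Rightarrow> real"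
  assumes "\<alpha> > 1" and "c > 0"
    and "\<And>n. M n = exp (c * real n powr \<alpha>)"
  shows "(\<forall>\<psi> \<in> carleman_class M {-1..1}.
            (\<lambda>l. norm (pv_osc \<psi> l)) \<in> O[at_top](\<lambda>l. ln l powr (1 - 1 / \<alpha>))) \<and>
         (\<exists>\<psi> \<in> carleman_class M {-1..1}. \<exists>\<Lambda> :: nat \<Rightarrow> real.
            (\<forall>n. \<Lambda> n > 0) \<and> filterlim \<Lambda> at_top sequentially \<and>
            (\<exists>c'>0. \<exists>C'>0. \<forall>\<^sub>F n in sequentially.
               c' * ln (\<Lambda> n) powr (1 - 1 / \<alpha>) \<le> norm (pv_osc \<psi> (\<Lambda> n)) \<and>
               norm (pv_osc \<psi> (\<Lambda> n)) \<le> C' * ln (\<Lambda> n) powr (1 - 1 / \<alpha>)))"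
proof
  show upper: "\<forall>\<psi> \<in> carleman_class M {-1..1}.
      (\<lambda>l. norm (pv_osc \<psi> l)) \<in> O[at_top](\<lambda>l. ln l powr (1 - 1 / \<alpha>))"
    using carleman_class_pv_osc_bigo assms by blast
  define \<gamma> where "\<gamma> = \<alpha> / (\<alpha> - 1)"
  have \<gamma>: "\<gamma> > 0" "\<gamma> * (1 - 1 / \<alpha>) = 1" using assms(1) by (auto simp: \<gamma>_def field_simps)
  obtain A where A: "A > 0" and mem: "ramp_series A \<gamma> 0 \<in> carleman_class M {-1..1}"
    using ramp_series_in_carleman_class[OF assms] by (auto simp: \<gamma>_def)
  define \<psi> where "\<psi> = ramp_series A \<gamma> 0"
  define \<Lambda> where "\<Lambda> n = exp (A * real n powr \<gamma>)" for n
  define a where "a = A powr (1 - 1 / \<alpha>)"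
  have a: "a > 0" using A by (simp add: a_def)
  have ln\<Lambda>: "ln (\<Lambda> n) powr (1 - 1 / \<alpha>) = a * real n" for n
    using A \<gamma> by (simp add: \<Lambda>_def a_def powr_mult powr_powr)
  have lim: "filterlim \<Lambda> at_top sequentially"
    unfolding \<Lambda>_def using A \<gamma> by real_asymp
  obtain C' where C': "C' > 0"
    "\<forall>\<^sub>F l in at_top. norm (norm (pv_osc \<psi> l)) \<le> C' * norm (ln l powr (1 - 1 / \<alpha>))"
    using bspec[OF upper mem] unfolding \<psi>_def by (rule landau_o.bigE)
  have up: "\<forall>\<^sub>F n in sequentially. norm (pv_osc \<psi> (\<Lambda> n)) \<le> C' * ln (\<Lambda> n) powr (1 - 1 / \<alpha>)"
    using filterlim_iff[THEN iffD1, OF lim, rule_format, OF C'(2)] by simp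
  have "\<forall>\<^sub>F n in sequentially. exp 1 \<le> real n * (ln 2 / 2)"
    by real_asymp
  then have low: "\<forall>\<^sub>F n in sequentially. ln 2 / (2 * a) * ln (\<Lambda> n) powr (1 - 1 / \<alpha>) \<le> norm (pv_osc \<psi> (\<Lambda> n))"
  proof eventually_elim
    case (elim n)
    have "ln 2 / (2 * a) * ln (\<Lambda> n) powr (1 - 1 / \<alpha>) = real n * (ln 2 / 2)"
      using a by (simp add: ln\<Lambda>)
    also have "\<dots> \<le> real n * ln 2 - exp 1" using elim by simp
    also have "\<dots> \<le> norm (pv_osc \<psi> (\<Lambda> n))"
      using pv_osc_ramp_series_ge[OF A assms(1), of n] by (simp add: \<psi>_def \<Lambda>_def \<gamma>_def)
    finally show ?case .
  qed
  have "\<forall>\<^sub>F n in sequentially.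
      ln 2 / (2 * a) * ln (\<Lambda> n) powr (1 - 1 / \<alpha>) \<le> norm (pv_osc \<psi> (\<Lambda> n)) \<and>
      norm (pv_osc \<psi> (\<Lambda> n)) \<le> C' * ln (\<Lambda> n) powr (1 - 1 / \<alpha>)"
    using low up by eventually_elim auto
  moreover have "\<forall>n. \<Lambda> n > 0" by (simp add: \<Lambda>_def)
  moreover have "ln 2 / (2 * a) > 0" using a by simp
  ultimately show "\<exists>\<psi> \<in> carleman_class M {-1..1}. \<exists>\<Lambda> :: nat \<Rightarrow> real.
      (\<forall>n. \<Lambda> n > 0) \<and> filterlim \<Lambda> at_top sequentially \<and>
      (\<exists>c'>0. \<exists>C'>0. \<forall>\<^sub>F n in sequentially.
         c' * ln (\<Lambda> n) powr (1 - 1 / \<alpha>) \<le> norm (pv_osc \<psi> (\<Lambda> n)) \<and>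
         norm (pv_osc \<psi> (\<Lambda> n)) \<le> C' * ln (\<Lambda> n) powr (1 - 1 / \<alpha>))"
    using mem lim C'(1) unfolding \<psi>_def[symmetric] by blast
qed

end
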